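(* Let $M$ be a countable transitive model of ${\sf ZF}^-$ in which every set is countable, and let $\mathbb{M}=\langle M,\mathcal{C}\rangle$, where $\mathcal{C}$ is the collection of classes definable over $\langle M,\in\rangle$ with parameters. Let $\mathbb{P}$ be the notion of class forcing whose conditions are all partial functions $p$ from $\omega$ to $2$ with $p\in M$ (not necessarily finite), ordered by reverse inclusion, and let $\mathbb{Q}$ be the finite support product of $\omega$ many copies of $\mathbb{P}$ (conditions: sequences $\langle p_i\mid i<\omega\rangle\in M$ with each $p_i\in\mathbb{P}$ and $p_i=\emptyset$ for all but finitely many $i$, ordered coordinatewise). Then $\mathbb{Q}$ does not satisfy the forcing theorem over $\mathbb{M}$.
   Context: A notion of class forcing for $\mathbb{M}$ is a partial order $\mathbb{P}=\langle P,\le_\mathbb{P}\rangle$ with $P,\le_\mathbb{P}\in\mathcal{C}$. $\mathbb{P}$-names are defined recursively as sets of pairs $\langle\tau,p\rangle$ with $\tau$ a $\mathbb{P}$-name and $p\in P$; $M^\mathbb{P}$ is the set of $\mathbb{P}$-names belonging to $M$, and $\mathcal{C}^\mathbb{P}$ the set of $\mathbb{P}$-names belonging to $\mathcal{C}$ (class names). A filter $G$ on $\mathbb{P}$ is $\mathbb{P}$-generic over $\mathbb{M}$ if it meets every dense subset of $\mathbb{P}$ that lies in $\mathcal{C}$. $\sigma^G=\{\tau^G\mid\exists p\in G\,\langle\tau,p\rangle\in\sigma\}$ (similarly for class names), and $M[G]=\{\sigma^G\mid\sigma\in M^\mathbb{P}\}$. For a first-order $\in$-formula $\varphi(v_0,\dots,v_{m-1},\vec\Gamma)$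 with class name parameters $\vec\Gamma=\Gamma_0,\dots,\Gamma_{n-1}\in\mathcal{C}^\mathbb{P}$, $p\in P$ and $\vec\sigma\in(M^\mathbb{P})^m$, write $p\Vdash_\mathbb{P}\varphi(\vec\sigma,\vec\Gamma)$ if for every $\mathbb{P}$-generic $G$ over $\mathbb{M}$ with $p\in G$, $\langle M[G],\Gamma_0^G,\dots,\Gamma_{n-1}^G\rangle\models\varphi(\sigma_0^G,\dots,\sigma_{m-1}^G,\Gamma^G_0,\dots)$. $\mathbb{P}$ satisfies the forcing theorem over $\mathbb{M}$ if for every such formula $\varphi$ and parameters $\vec\Gamma$: (definability) $\{\langle p,\vec\sigma\rangle\in P\times(M^\mathbb{P})^m\mid p\Vdash_\mathbb{P}\varphi(\vec\sigma,\vec\Gamma)\}\in\mathcal{C}$, and (truth) whenever $G$ is $\mathbb{P}$-generic over $\mathbb{M}$ and $\langle M[G],\vec\Gamma^G\rangle\models\varphi(\vec\sigma^G,\vec\Gamma^G)$, there is $p\in G$ with $p\Vdash_\mathbb{P}\varphi(\vec\sigma,\vec\Gamma)$. *)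

theory Defs
  imports "HOL-Library.Countable_Set_Type"
begin

section \<open>Hereditarily countable sets\<close>

text \<open>
  The initial algebra of the countable-powerset functor is the universe of hereditarily countable
  sets.  Every countable transitive set \<open>M\<close>, all its elements, all its subsets, and every generic
  extension \<open>M[G]\<close> live inside it, so a countable transitive model is literally a countable
  transitive \<open>M :: hc set\<close> with the true membership relation \<open>x \<in> elts y\<close>.
\<close>

datatype hc = HC "hc cset"

definition elts :: "hc \<Rightarrow> hc set" where
  "elts x = (case x of HC c \<Rightarrow> rcset c)"

text \<open>Only meaningful for countable arguments; all uses below are countable.\<close>

definition hcset :: "hc set \<Rightarrow> hc" where
  "hcset A = HC (acset A)"

lemma elts_hcset [simp]: "countable A \<Longrightarrow> elts (hcset A) = A"
  by (simp add: elts_def hcset_def)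

lemma countable_elts [simp]: "countable (elts x)"
  by (cases x) (simp add: elts_def)

lemma hc_ext: "elts x = elts y \<Longrightarrow> x = y"
  by (cases x, cases y) (simp add: elts_def rcset_inject)

lemma hc_induct [case_names step]:
  assumes "\<And>x. (\<And>y. y \<in> elts x \<Longrightarrow> R y) \<Longrightarrow> R x"
  shows "R x"
  by (induction x) (rule assms, simp add: elts_def)

lemma wf_elts: "wf {(y, x). y \<in> elts x}"
  unfolding wf_def by (blast intro: hc_induct)

definition hempty :: hc where
  "hempty = hcset {}"

definition hpair :: "hc \<Rightarrow> hc \<Rightarrow> hc" where
  "hpair x y = hcset {hcset {x}, hcset {x, y}}"

primrec hnat :: "nat \<Rightarrow> hc" where
  "hnat 0 = hempty"
| "hnat (Suc n) = hcset (insert (hnat n) (elts (hnat n)))"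

definition homega :: hc where
  "homega = hcset (range hnat)"

definition hfunction :: "hc \<Rightarrow> bool" where
  "hfunction f \<longleftrightarrow> (\<forall>z\<in>elts f. \<exists>x y. z = hpair x y) \<and>
     (\<forall>x y y'. hpair x y \<in> elts f \<longrightarrow> hpair x y' \<in> elts f \<longrightarrow> y = y')"

definition hinjective :: "hc \<Rightarrow> bool" where
  "hinjective f \<longleftrightarrow> (\<forall>x x' y. hpair x y \<in> elts f \<longrightarrow> hpair x' y \<in> elts f \<longrightarrow> x = x')"

definition hdom :: "hc \<Rightarrow> hc set" where
  "hdom f = {x. \<exists>y. hpair x y \<in> elts f}"

definition hran :: "hc \<Rightarrow> hc set" where
  "hran f = {y. \<exists>x. hpair x y \<in> elts f}"

text \<open>\<open>htuple x [y, \<dots>, z]\<close> is the set-theoretic tuple \<open>\<langle>x, \<langle>y, \<dots> z\<rangle>\<rangle>\<close>.\<close>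

primrec htuple :: "hc \<Rightarrow> hc list \<Rightarrow> hc" where
  "htuple x [] = x"
| "htuple x (y # ys) = hpair x (htuple y ys)"


section \<open>First-order formulas with class predicates\<close>

text \<open>
  De Bruijn formulas: \<open>Mem i j\<close> is \<open>v\<^sub>i \<in> v\<^sub>j\<close>, \<open>Cls i k\<close> is \<open>v\<^sub>i \<in> \<Gamma>\<^sub>k\<close>, and \<open>Ex\<close> binds index 0.
\<close>

datatype fm = Mem nat nat | Eq nat nat | Cls nat nat | Neg fm | Conj fm fm | Ex fm

text \<open>All free variables are below \<open>m\<close> and all class symbols are below \<open>n\<close>.\<close>

primrec fm_over :: "nat \<Rightarrow> nat \<Rightarrow> fm \<Rightarrow> bool" where
  "fm_over m n (Mem i j) \<longleftrightarrow> i < m \<and> j < m"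
| "fm_over m n (Eq i j) \<longleftrightarrow> i < m \<and> j < m"
| "fm_over m n (Cls i k) \<longleftrightarrow> i < m \<and> k < n"
| "fm_over m n (Neg \<phi>) \<longleftrightarrow> fm_over m n \<phi>"
| "fm_over m n (Conj \<phi> \<psi>) \<longleftrightarrow> fm_over m n \<phi> \<and> fm_over m n \<psi>"
| "fm_over m n (Ex \<phi>) \<longleftrightarrow> fm_over (Suc m) n \<phi>"

primrec sat :: "hc set \<Rightarrow> hc set list \<Rightarrow> fm \<Rightarrow> hc list \<Rightarrow> bool" where
  "sat M As (Mem i j) xs \<longleftrightarrow> xs ! i \<in> elts (xs ! j)"
| "sat M As (Eq i j) xs \<longleftrightarrow> xs ! i = xs ! j"
| "sat M As (Cls i k) xs \<longleftrightarrow> xs ! i \<in> As ! k"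
| "sat M As (Neg \<phi>) xs \<longleftrightarrow> \<not> sat M As \<phi> xs"
| "sat M As (Conj \<phi> \<psi>) xs \<longleftrightarrow> sat M As \<phi> xs \<and> sat M As \<psi> xs"
| "sat M As (Ex \<phi>) xs \<longleftrightarrow> (\<exists>x\<in>M. sat M As \<phi> (x # xs))"


section \<open>Models\<close>

definition transitive_set :: "hc set \<Rightarrow> bool" where
  "transitive_set M \<longleftrightarrow> (\<forall>x\<in>M. elts x \<subseteq> M)"

text \<open>
  \<open>\<langle>M,\<in>\<rangle>\<close> satisfies ZF without power set.  The axioms are written out with quantifiers relativized
  to \<open>M\<close>; as usual for this theory, the replacement axioms are taken in the form of Separation and
  Collection.
\<close>

definition ZF_minus :: "hc set \<Rightarrow> bool" where
  "ZF_minus M \<longleftrightarrow>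
    \<comment> \<open>Extensionality\<close>
    (\<forall>x\<in>M. \<forall>y\<in>M. (\<forall>z\<in>M. z \<in> elts x \<longleftrightarrow> z \<in> elts y) \<longrightarrow> x = y) \<and>
    \<comment> \<open>Foundation\<close>
    (\<forall>x\<in>M. (\<exists>y\<in>M. y \<in> elts x) \<longrightarrow> (\<exists>y\<in>M. y \<in> elts x \<and> \<not> (\<exists>z\<in>M. z \<in> elts x \<and> z \<in> elts y))) \<and>
    \<comment> \<open>Pairing\<close>
    (\<forall>x\<in>M. \<forall>y\<in>M. \<exists>z\<in>M. \<forall>u\<in>M. u \<in> elts z \<longleftrightarrow> u = x \<or> u = y) \<and>
    \<comment> \<open>Union\<close>
    (\<forall>x\<in>M. \<exists>z\<in>M. \<forall>u\<in>M. u \<in> elts z \<longleftrightarrow> (\<exists>y\<in>M. y \<in> elts x \<and> u \<in> elts y)) \<and>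
    \<comment> \<open>Infinity\<close>
    (\<exists>w\<in>M. (\<exists>z\<in>M. z \<in> elts w \<and> (\<forall>u\<in>M. u \<notin> elts z)) \<and>
       (\<forall>y\<in>M. y \<in> elts w \<longrightarrow>
          (\<exists>s\<in>M. s \<in> elts w \<and> (\<forall>u\<in>M. u \<in> elts s \<longleftrightarrow> u \<in> elts y \<or> u = y)))) \<and>
    \<comment> \<open>Separation\<close>
    (\<forall>\<phi> ps. fm_over (Suc (length ps)) 0 \<phi> \<longrightarrow> set ps \<subseteq> M \<longrightarrow>
       (\<forall>a\<in>M. \<exists>b\<in>M. \<forall>x\<in>M. x \<in> elts b \<longleftrightarrow> x \<in> elts a \<and> sat M [] \<phi> (x # ps))) \<and>
    \<comment> \<open>Collection\<close>
    (\<forall>\<phi> ps. fm_over (Suc (Suc (length ps))) 0 \<phi> \<longrightarrow> set ps \<subseteq> M \<longrightarrow>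
       (\<forall>a\<in>M. (\<forall>x\<in>M. x \<in> elts a \<longrightarrow> (\<exists>y\<in>M. sat M [] \<phi> (x # y # ps))) \<longrightarrow>
          (\<exists>b\<in>M. \<forall>x\<in>M. x \<in> elts a \<longrightarrow> (\<exists>y\<in>M. y \<in> elts b \<and> sat M [] \<phi> (x # y # ps)))))"

text \<open>
  \<open>M\<close> thinks that every set is countable: the witnessing injection into \<open>\<omega>\<close> belongs to \<open>M\<close>.  Being
  such an injection is absolute for the transitive models considered here.
\<close>

definition every_set_countable_in :: "hc set \<Rightarrow> bool" where
  "every_set_countable_in M \<longleftrightarrow>
    (\<forall>x\<in>M. \<exists>f\<in>M. hfunction f \<and> hinjective f \<and> hdom f = elts x \<and> hran f \<subseteq> elts homega)"

definition definable_classes :: "hc set \<Rightarrow> hc set set" where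
  "definable_classes M =
    {{x \<in> M. sat M [] \<phi> (x # ps)} | \<phi> ps. fm_over (Suc (length ps)) 0 \<phi> \<and> set ps \<subseteq> M}"


section \<open>Class forcing\<close>

text \<open>
  Below, \<open>M\<close> and \<open>C\<close> are the sets and classes of the ground model, \<open>P\<close> is the class of conditions,
  and \<open>le\<close> is the order, as a class of pairs \<open>hpair p q\<close> with \<open>p\<close> stronger than \<open>q\<close>.
\<close>

inductive is_name :: "hc set \<Rightarrow> hc \<Rightarrow> bool" for P :: "hc set" where
  "(\<And>x. x \<in> elts \<sigma> \<Longrightarrow> \<exists>\<tau> p. x = hpair \<tau> p \<and> is_name P \<tau> \<and> p \<in> P) \<Longrightarrow> is_name P \<sigma>"

definition set_names :: "hc set \<Rightarrow> hc set \<Rightarrow> hc set" where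
  "set_names M P = {\<sigma> \<in> M. is_name P \<sigma>}"

definition class_names :: "hc set set \<Rightarrow> hc set \<Rightarrow> hc set set" where
  "class_names C P = {\<Gamma> \<in> C. \<forall>x\<in>\<Gamma>. \<exists>\<tau> p. x = hpair \<tau> p \<and> is_name P \<tau> \<and> p \<in> P}"

function name_val :: "hc set \<Rightarrow> hc \<Rightarrow> hc" where
  "name_val G \<sigma> = hcset (name_val G ` {\<tau>. \<exists>p\<in>G. hpair \<tau> p \<in> elts \<sigma>})"
  by pat_completeness auto
termination
proof (relation "inv_image ({(y, x). y \<in> elts x}\<^sup>+) snd")
  show "wf (inv_image ({(y, x). y \<in> elts x}\<^sup>+) (snd :: hc set \<times> hc \<Rightarrow> hc))"
    by (intro wf_inv_image wf_trancl wf_elts)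
next
  fix G :: "hc set" and \<sigma> \<tau> :: hc
  let ?E = "{(y, x). y \<in> elts x}"
  assume "\<tau> \<in> {\<tau>. \<exists>p\<in>G. hpair \<tau> p \<in> elts \<sigma>}"
  then obtain p where "(hpair \<tau> p, \<sigma>) \<in> ?E"
    by blast
  moreover have "(\<tau>, hcset {\<tau>}) \<in> ?E" "(hcset {\<tau>}, hpair \<tau> p) \<in> ?E"
    by (simp_all add: hpair_def)
  ultimately have "(\<tau>, \<sigma>) \<in> ?E\<^sup>+"
    by (meson trancl.intros)
  then show "((G, \<tau>), (G, \<sigma>)) \<in> inv_image (?E\<^sup>+) snd"
    by simp
qed

declare name_val.simps [simp del]

definition class_name_val :: "hc set \<Rightarrow> hc set \<Rightarrow> hc set" where
  "class_name_val G \<Gamma> = name_val G ` {\<tau>. \<exists>p\<in>G. hpair \<tau> p \<in> \<Gamma>}"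

definition extension :: "hc set \<Rightarrow> hc set \<Rightarrow> hc set \<Rightarrow> hc set" where
  "extension M P G = name_val G ` set_names M P"

definition is_filter :: "hc set \<Rightarrow> hc set \<Rightarrow> hc set \<Rightarrow> bool" where
  "is_filter P le G \<longleftrightarrow> G \<subseteq> P \<and> G \<noteq> {} \<and>
     (\<forall>p\<in>G. \<forall>q\<in>P. hpair p q \<in> le \<longrightarrow> q \<in> G) \<and>
     (\<forall>p\<in>G. \<forall>q\<in>G. \<exists>r\<in>G. hpair r p \<in> le \<and> hpair r q \<in> le)"

definition is_dense :: "hc set \<Rightarrow> hc set \<Rightarrow> hc set \<Rightarrow> bool" where
  "is_dense P le D \<longleftrightarrow> D \<subseteq> P \<and> (\<forall>p\<in>P. \<exists>q\<in>D. hpair q p \<in> le)"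

definition generic :: "hc set set \<Rightarrow> hc set \<Rightarrow> hc set \<Rightarrow> hc set \<Rightarrow> bool" where
  "generic C P le G \<longleftrightarrow> is_filter P le G \<and> (\<forall>D\<in>C. is_dense P le D \<longrightarrow> G \<inter> D \<noteq> {})"

definition sat_extension ::
    "hc set \<Rightarrow> hc set \<Rightarrow> hc set \<Rightarrow> hc set list \<Rightarrow> fm \<Rightarrow> hc list \<Rightarrow> bool" where
  "sat_extension M P G \<Gamma>s \<phi> \<sigma>s \<longleftrightarrow>
     sat (extension M P G) (map (class_name_val G) \<Gamma>s) \<phi> (map (name_val G) \<sigma>s)"

definition forces ::
    "hc set \<Rightarrow> hc set set \<Rightarrow> hc set \<Rightarrow> hc set \<Rightarrow> hc \<Rightarrow> hc set list \<Rightarrow> fm \<Rightarrow> hc list \<Rightarrow> bool" where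
  "forces M C P le p \<Gamma>s \<phi> \<sigma>s \<longleftrightarrow>
     (\<forall>G. generic C P le G \<longrightarrow> p \<in> G \<longrightarrow> sat_extension M P G \<Gamma>s \<phi> \<sigma>s)"

definition forcing_theorem :: "hc set \<Rightarrow> hc set set \<Rightarrow> hc set \<Rightarrow> hc set \<Rightarrow> bool" where
  "forcing_theorem M C P le \<longleftrightarrow>
     (\<forall>m \<phi> \<Gamma>s. fm_over m (length \<Gamma>s) \<phi> \<longrightarrow> set \<Gamma>s \<subseteq> class_names C P \<longrightarrow>
        \<comment> \<open>definability\<close>
        {htuple p \<sigma>s | p \<sigma>s. p \<in> P \<and> length \<sigma>s = m \<and> set \<sigma>s \<subseteq> set_names M P \<and>
            forces M C P le p \<Gamma>s \<phi> \<sigma>s} \<in> C \<and>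
        \<comment> \<open>truth\<close>
        (\<forall>G \<sigma>s. generic C P le G \<longrightarrow> length \<sigma>s = m \<longrightarrow> set \<sigma>s \<subseteq> set_names M P \<longrightarrow>
            sat_extension M P G \<Gamma>s \<phi> \<sigma>s \<longrightarrow> (\<exists>p\<in>G. forces M C P le p \<Gamma>s \<phi> \<sigma>s)))"


section \<open>The forcings P and Q\<close>

definition P_conds :: "hc set \<Rightarrow> hc set" where
  "P_conds M = {p \<in> M. hfunction p \<and> hdom p \<subseteq> elts homega \<and> hran p \<subseteq> {hnat 0, hnat 1}}"

definition P_le :: "hc set \<Rightarrow> hc set" where
  "P_le M = {hpair p q | p q. p \<in> P_conds M \<and> q \<in> P_conds M \<and> elts q \<subseteq> elts p}"

definition Q_conds :: "hc set \<Rightarrow> hc set" where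
  "Q_conds M = {s \<in> M. hfunction s \<and> hdom s = elts homega \<and> hran s \<subseteq> P_conds M \<and>
     finite {i. \<exists>p. hpair i p \<in> elts s \<and> p \<noteq> hempty}}"

definition Q_le :: "hc set \<Rightarrow> hc set" where
  "Q_le M = {hpair s t | s t. s \<in> Q_conds M \<and> t \<in> Q_conds M \<and>
     (\<forall>i p q. hpair i p \<in> elts s \<longrightarrow> hpair i q \<in> elts t \<longrightarrow> hpair p q \<in> P_le M)}"

end

theory Submission
  imports Defs
begin

text \<open>
  Total conditions are atoms of \<open>P\<close>, so a generic filter for \<open>Q\<close> is a sequence of reals of \<open>M\<close>
  in which every real of \<open>M\<close> occurs.  As every set of \<open>M\<close> is countable in \<open>M\<close>, it is coded by a
  real, and the generic sequence yields an enumeration of \<open>M\<close> in order type \<open>\<omega>\<close>.  Quantifiers over \<open>M\<close>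
  thereby become countable disjunctions and conjunctions, and these can be absorbed into names: for
  every definable class \<open>X\<close> there are set names \<open>\<sigma>\<close>, \<open>\<tau>\<close> such that, whenever \<open>p\<close> fixes the first real of
  the sequence to be a code of \<open>a\<close>, \<open>p\<close> forces \<open>\<sigma> = \<tau>\<close> iff \<open>a \<in> X\<close>.  If the forcing relation for
  \<open>v\<^sub>0 = v\<^sub>1\<close> were a class, the definable classes would be uniformly enumerated by pairs
  \<open>\<langle>\<sigma>, \<tau>\<rangle> \<in> M\<close>, and diagonalization gives a contradiction.
\<close>

section \<open>Definability over a transitive model\<close>

text \<open>Finite support is what makes every real of \<open>M\<close> occur: beyond the support of
  a condition a coordinate is still empty and can be extended to any total function in
  \<open>M\<close>. Because the product is to violate the forcing theorem, no property of the
  forcing relation is available; every name is therefore evaluated directly, in all generic filters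
  at once.

  A name is a set, so a truth definition that runs through all of \<open>M\<close> does not fit into
  one; a definition that runs through the indices of the generic sequence does, since the names of
  its countably many instances form a set of \<open>M\<close> by replacement. This forces equality
  and membership of coded sets to be expressed by quantifiers over indices alone. The resulting
  infinitary statement must then become an equation between two names, which is why truth values are
  represented by two distinct sets.

  For the diagonal argument, \<sigma> has to be tested at the pair \<langle>\<sigma>,
  \<tau>\<rangle>, while \<sigma> must be fixed before this pair exists. Hence the tested set is
  supplied by the condition and not by the name: \<sigma> depends on the class only.\<close>

primrec fm_rename :: "(nat \<Rightarrow> nat) \<Rightarrow> fm \<Rightarrow> fm" where
  "fm_rename f (Mem i j) = Mem (f i) (f j)"
| "fm_rename f (Eq i j) = Eq (f i) (f j)"
| "fm_rename f (Cls i k) = Cls (f i) k"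
| "fm_rename f (Neg \<phi>) = Neg (fm_rename f \<phi>)"
| "fm_rename f (Conj \<phi> \<psi>) = Conj (fm_rename f \<phi>) (fm_rename f \<psi>)"
| "fm_rename f (Ex \<phi>) = Ex (fm_rename (case_nat 0 (\<lambda>i. Suc (f i))) \<phi>)"

lemma fm_over_rename:
  assumes "fm_over m n \<phi>" "\<And>i. i < m \<Longrightarrow> f i < m'"
  shows "fm_over m' n (fm_rename f \<phi>)"
  using assms
proof (induction \<phi> arbitrary: m m' f)
  case (Ex \<phi>)
  then show ?case
    by (auto split: nat.split intro!: Ex.IH[of "Suc m"])
qed auto

lemma sat_rename:
  assumes "fm_over (length ys) n \<phi>" "\<And>i. i < length ys \<Longrightarrow> ys ! i = xs ! f i"
  shows "sat M As (fm_rename f \<phi>) xs = sat M As \<phi> ys"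
  using assms
proof (induction \<phi> arbitrary: xs ys f)
  case (Ex \<phi>)
  have "sat M As (fm_rename (case_nat 0 (\<lambda>i. Suc (f i))) \<phi>) (x # xs) = sat M As \<phi> (x # ys)" for x
    using Ex.prems by (intro Ex.IH) (auto split: nat.split simp: nth_Cons)
  then show ?case by simp
qed auto

lemma hempty_elts [simp]: "elts hempty = {}"
  by (simp add: hempty_def)

lemma hcset_elts [simp]: "hcset (elts x) = x"
  by (rule hc_ext) simp

lemma hcset_inject: "countable A \<Longrightarrow> countable B \<Longrightarrow> hcset A = hcset B \<longleftrightarrow> A = B"
  by (metis elts_hcset)

lemma hpair_inject [simp]: "hpair x y = hpair x' y' \<longleftrightarrow> x = x' \<and> y = y'"
proof
  assume h: "hpair x y = hpair x' y'"
  then have "{hcset {x}, hcset {x, y}} = {hcset {x'}, hcset {x', y'}}"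
    by (simp add: hpair_def hcset_inject)
  then have "{{x}, {x, y}} = {{x'}, {x', y'}}"
    by (auto simp: doubleton_eq_iff hcset_inject)
  then show "x = x' \<and> y = y'"
    by (auto simp: doubleton_eq_iff)
qed auto

lemma not_mem_self: "x \<notin> elts x"
  using wf_elts by (metis (mono_tags, lifting) case_prodI mem_Collect_eq wf_not_refl)

lemma hnat_less: "elts (hnat n) = hnat ` {..<n}"
  by (induction n) (auto simp: lessThan_Suc)

lemma inj_hnat: "inj hnat"
proof (rule linorder_injI)
  fix m n :: nat assume "m < n"
  then have "hnat m \<in> elts (hnat n)" by (auto simp: hnat_less)
  then show "hnat m \<noteq> hnat n" using not_mem_self by metis
qed

lemma elts_homega [simp]: "elts homega = range hnat"
  by (simp add: homega_def)

lemma hnat_omega [simp]: "hnat n \<in> elts homega"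
  by simp

lemma hempty_hnat: "hempty = hnat 0" by simp

section \<open>Relations and operations definable over a transitive model\<close>

locale zf_model =
  fixes M :: "hc set"
  assumes trans_M: "transitive_set M" and zf: "ZF_minus M"
begin

lemma trans: "x \<in> M \<Longrightarrow> y \<in> elts x \<Longrightarrow> y \<in> M"
  using trans_M by (auto simp: transitive_set_def)

lemmas zf_axioms = zf[unfolded ZF_minus_def]
lemmas zf_pairing = zf_axioms[THEN conjunct2, THEN conjunct2, THEN conjunct1]
lemmas zf_union = zf_axioms[THEN conjunct2, THEN conjunct2, THEN conjunct2, THEN conjunct1]
lemmas zf_infinity = zf_axioms[THEN conjunct2, THEN conjunct2, THEN conjunct2, THEN conjunct2, THEN conjunct1]
lemmas zf_separation = zf_axioms[THEN conjunct2, THEN conjunct2, THEN conjunct2, THEN conjunct2, THEN conjunct2, THEN conjunct1]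
lemmas zf_collection = zf_axioms[THEN conjunct2, THEN conjunct2, THEN conjunct2, THEN conjunct2, THEN conjunct2, THEN conjunct2]

lemma ext_M: "x \<in> M \<Longrightarrow> y \<in> M \<Longrightarrow> (\<forall>z\<in>M. z \<in> elts x \<longleftrightarrow> z \<in> elts y) \<longleftrightarrow> x = y"
  by (metis hc_ext subsetI subset_antisym trans)

text \<open>Environments are total functions, so that renaming is composition and binding is
  \<open>case_nat\<close>, without length conditions; a formula reads only an initial segment
  \<open>[0..<m]\<close>.\<close>

definition Menv :: "(nat \<Rightarrow> hc) \<Rightarrow> bool" where
  "Menv e \<longleftrightarrow> (\<forall>k. e k \<in> M)"

lemma Menv_case_nat [simp]: "Menv (case_nat x e) \<longleftrightarrow> x \<in> M \<and> Menv e"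
  unfolding Menv_def by (metis old.nat.simps(4,5) not0_implies_Suc)

lemma Menv_const [simp]: "Menv (\<lambda>_. c) \<longleftrightarrow> c \<in> M"
  by (simp add: Menv_def)

lemma Menv_comp: "Menv e \<Longrightarrow> Menv (\<lambda>k. e (r k))"
  by (simp add: Menv_def)

lemma MenvD: "Menv e \<Longrightarrow> e k \<in> M"
  by (simp add: Menv_def)

text \<open>
  Definability with parameters of a relation on environments.  The values of \<open>P\<close> on environments that leave
  \<open>M\<close> are irrelevant.
\<close>

definition dfn :: "((nat \<Rightarrow> hc) \<Rightarrow> bool) \<Rightarrow> bool" where
  "dfn P \<longleftrightarrow> (\<exists>\<phi> m ps. set ps \<subseteq> M \<and> fm_over (m + length ps) 0 \<phi> \<and>
     (\<forall>e. Menv e \<longrightarrow> sat M [] \<phi> (map e [0..<m] @ ps) = P e))"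

lemma dfn_cong: "dfn P \<Longrightarrow> (\<And>e. Menv e \<Longrightarrow> P e = Q e) \<Longrightarrow> dfn Q"
  unfolding dfn_def by metis

lemma dfn_subst:
  assumes "dfn P"
  shows "dfn (\<lambda>e. P (\<lambda>k. e (r k)))"
proof -
  obtain \<phi> m ps where 1: "set ps \<subseteq> M" "fm_over (m + length ps) 0 \<phi>"
    and 2: "\<And>e. Menv e \<Longrightarrow> sat M [] \<phi> (map e [0..<m] @ ps) = P e"
    using assms by (auto simp: dfn_def)
  \<comment> \<open>The \<open>{0}\<close> keeps \<open>Max\<close> off the empty set when
    \<open>m = 0\<close>.\<close>
  define m' where "m' = Suc (Max (r ` {..<m} \<union> {0}))"
  have m': "r i < m'" if "i < m" for i
    using that unfolding m'_def by (auto intro!: Max_ge le_imp_less_Suc)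
  define f where "f i = (if i < m then r i else m' + (i - m))" for i
  have "sat M [] (fm_rename f \<phi>) (map e [0..<m'] @ ps) = P (\<lambda>k. e (r k))" if "Menv e" for e
  proof -
    have "sat M [] (fm_rename f \<phi>) (map e [0..<m'] @ ps) = sat M [] \<phi> (map (\<lambda>k. e (r k)) [0..<m] @ ps)"
      using 1 m' by (intro sat_rename) (auto simp: f_def nth_append)
    then show ?thesis using 2[of "\<lambda>k. e (r k)"] that by (simp add: Menv_comp)
  qed
  moreover have "fm_over (m' + length ps) 0 (fm_rename f \<phi>)"
    using 1(2) by (rule fm_over_rename) (use m' in \<open>auto simp: f_def trans_less_add1\<close>)
  ultimately show ?thesis using 1 by (auto simp: dfn_def)
qed

lemma dfn_neg: "dfn P \<Longrightarrow> dfn (\<lambda>e. \<not> P e)"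
  unfolding dfn_def by (metis fm_over.simps(4) sat.simps(4))

lemma dfn_conj:
  assumes "dfn P" "dfn Q"
  shows "dfn (\<lambda>e. P e \<and> Q e)"
proof -
  obtain \<phi> m ps where 1: "set ps \<subseteq> M" "fm_over (m + length ps) 0 \<phi>"
    and 2: "\<And>e. Menv e \<Longrightarrow> sat M [] \<phi> (map e [0..<m] @ ps) = P e"
    using assms by (auto simp: dfn_def)
  obtain \<psi> m' ps' where 3: "set ps' \<subseteq> M" "fm_over (m' + length ps') 0 \<psi>"
    and 4: "\<And>e. Menv e \<Longrightarrow> sat M [] \<psi> (map e [0..<m'] @ ps') = Q e"
    using assms by (auto simp: dfn_def)
  \<comment> \<open>The joint list holds \<open>m + m'\<close> variables followed by
    \<open>ps @ ps'\<close>. Parameters of \<phi> move past \<open>m'\<close> further variables,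
    those of \<psi> past \<open>m\<close> further variables and \<open>ps\<close>.\<close>
  define f where "f i = (if i < m then i else m' + i)" for i
  define f' where "f' i = (if i < m' then i else m + length ps + i)" for i
  have "sat M [] (Conj (fm_rename f \<phi>) (fm_rename f' \<psi>)) (map e [0..<m + m'] @ (ps @ ps')) = (P e \<and> Q e)"
    if "Menv e" for e
  proof -
    have "sat M [] (fm_rename f \<phi>) (map e [0..<m + m'] @ (ps @ ps')) = sat M [] \<phi> (map e [0..<m] @ ps)"
      using 1 by (intro sat_rename) (auto simp: f_def nth_append)
    moreover have "sat M [] (fm_rename f' \<psi>) (map e [0..<m + m'] @ (ps @ ps')) = sat M [] \<psi> (map e [0..<m'] @ ps')"
      using 3 by (intro sat_rename) (auto simp: f'_def nth_append)
    ultimately show ?thesis using 2 4 that by simp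
  qed
  moreover have "fm_over (m + m' + length (ps @ ps')) 0 (fm_rename f \<phi>)"
    using 1(2) by (rule fm_over_rename) (auto simp: f_def)
  moreover have "fm_over (m + m' + length (ps @ ps')) 0 (fm_rename f' \<psi>)"
    using 3(2) by (rule fm_over_rename) (auto simp: f'_def)
  ultimately show ?thesis
    unfolding dfn_def using 1 3
    by (intro exI[of _ "Conj (fm_rename f \<phi>) (fm_rename f' \<psi>)"] exI[of _ "m + m'"] exI[of _ "ps @ ps'"]) auto
qed

lemma dfn_disj: "dfn P \<Longrightarrow> dfn Q \<Longrightarrow> dfn (\<lambda>e. P e \<or> Q e)"
  using dfn_neg[OF dfn_conj[OF dfn_neg[of P] dfn_neg[of Q]]] by simp

lemma dfn_imp: "dfn P \<Longrightarrow> dfn Q \<Longrightarrow> dfn (\<lambda>e. P e \<longrightarrow> Q e)"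
  unfolding imp_conv_disj by (intro dfn_disj dfn_neg)

lemma dfn_iff: "dfn P \<Longrightarrow> dfn Q \<Longrightarrow> dfn (\<lambda>e. P e \<longleftrightarrow> Q e)"
  unfolding iff_conv_conj_imp by (intro dfn_conj dfn_imp)

lemma dfn_ex_env:
  assumes "dfn P"
  shows "dfn (\<lambda>e. \<exists>x\<in>M. P (case_nat x e))"
proof -
  obtain \<phi> m ps where 1: "set ps \<subseteq> M" "fm_over (m + length ps) 0 \<phi>"
    and 2: "\<And>e. Menv e \<Longrightarrow> sat M [] \<phi> (map e [0..<m] @ ps) = P e"
    using assms by (auto simp: dfn_def)
  \<comment> \<open>The inner formula reads \<open>m\<close> entries of \<open>case_nat x e\<close>,
    but the outer list puts \<open>m + 1\<close> entries before the parameters: position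
    \<open>m\<close> is skipped. The same shift recurs in \<open>separation\<close> and
    \<open>dfn_class\<close>, and doubled in \<open>collection\<close>.\<close>
  define f where "f i = (if i < m then i else Suc i)" for i
  have "sat M [] (Ex (fm_rename f \<phi>)) (map e [0..<m] @ ps) = (\<exists>x\<in>M. P (case_nat x e))" if "Menv e" for e
  proof -
    have "sat M [] (fm_rename f \<phi>) (x # map e [0..<m] @ ps)
        = sat M [] \<phi> (map (case_nat x e) [0..<m] @ ps)" for x
      using 1 by (intro sat_rename) (auto simp: f_def nth_append nth_Cons Suc_diff_le split: nat.split)
    then show ?thesis using 2 that by simp
  qed
  moreover have "fm_over (m + length ps) 0 (Ex (fm_rename f \<phi>))"
    using fm_over_rename[OF 1(2), of f "Suc (m + length ps)"] by (auto simp: f_def)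
  ultimately show ?thesis
    unfolding dfn_def using 1
    by (intro exI[of _ "Ex (fm_rename f \<phi>)"] exI[of _ m] exI[of _ ps]) blast
qed

text \<open>The bound variable is a separate argument of \<open>P\<close>, so that the rule applies
  backwards to a relation written with an ordinary quantifier; \<open>\<lambda>n. e (Suc n)\<close>
  is the de Bruijn lift.\<close>

lemma dfn_ex:
  assumes "dfn (\<lambda>e. P (\<lambda>n. e (Suc n)) (e 0))"
  shows "dfn (\<lambda>e. \<exists>x\<in>M. P e x)"
  using dfn_ex_env[OF assms] by simp

lemma dfn_all:
  assumes "dfn (\<lambda>e. P (\<lambda>n. e (Suc n)) (e 0))"
  shows "dfn (\<lambda>e. \<forall>x\<in>M. P e x)"
  using dfn_neg[OF dfn_ex[OF dfn_neg[OF assms]]] by simp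

lemma dfn_mem_var: "dfn (\<lambda>e. e i \<in> elts (e j))"
  unfolding dfn_def
  by (intro exI[of _ "Mem i j"] exI[of _ "Suc (max i j)"] exI[of _ "[]"]) (auto simp: nth_append)

lemma dfn_eq_var: "dfn (\<lambda>e. e i = e j)"
  unfolding dfn_def
  by (intro exI[of _ "Eq i j"] exI[of _ "Suc (max i j)"] exI[of _ "[]"]) (auto simp: nth_append)

lemma dfn_eq_const: "c \<in> M \<Longrightarrow> dfn (\<lambda>e. e i = c)"
  unfolding dfn_def
  by (intro exI[of _ "Eq i (Suc i)"] exI[of _ "Suc i"] exI[of _ "[c]"]) (auto simp: nth_append)

lemma dfn_True: "dfn (\<lambda>e. True)"
  using dfn_cong[OF dfn_eq_var[of 0 0]] by simp

lemma dfn_False: "dfn (\<lambda>e. False)"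
  using dfn_neg[OF dfn_True] by simp

text \<open>Closure of \<open>M\<close> under \<open>t\<close> is part of the definition.\<close>

definition dterm :: "((nat \<Rightarrow> hc) \<Rightarrow> hc) \<Rightarrow> bool" where
  "dterm t \<longleftrightarrow> (\<forall>e. Menv e \<longrightarrow> t e \<in> M) \<and> dfn (\<lambda>e. e 0 = t (\<lambda>n. e (Suc n)))"

lemma dterm_M: "dterm t \<Longrightarrow> Menv e \<Longrightarrow> t e \<in> M"
  by (simp add: dterm_def)

lemma dterm_var: "dterm (\<lambda>e. e k)"
  by (auto simp: dterm_def dfn_eq_var MenvD)

lemma dterm_const: "c \<in> M \<Longrightarrow> dterm (\<lambda>e. c)"
  by (auto simp: dterm_def dfn_eq_const)

lemma dterm_subst:
  assumes "dterm t"
  shows "dterm (\<lambda>e. t (\<lambda>k. e (r k)))"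
proof -
  have "dfn (\<lambda>e. e 0 = t (\<lambda>n. e (Suc n)))"
    using assms by (simp add: dterm_def)
  from dfn_subst[OF this, of "case_nat 0 (\<lambda>i. Suc (r i))"]
  show ?thesis using assms by (simp add: dterm_def Menv_comp)
qed

lemma dterm_shift: "dterm t \<Longrightarrow> dterm (\<lambda>e. t (\<lambda>n. e (Suc n)))"
  by (rule dterm_subst)

text \<open>The term enters through \<open>\<exists>x\<in>M. x = t e \<and> ...\<close>; closure of
  \<open>M\<close> under \<open>t\<close> guarantees the witness.\<close>

lemma dfn_comp_env:
  assumes "dfn P" "dterm t"
  shows "dfn (\<lambda>e. P (case_nat (t e) e))"
proof -
  have [simp]: "case_nat (e 0) (\<lambda>n. e (Suc n)) = e" for e :: "nat \<Rightarrow> hc"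
    by (rule ext) (simp split: nat.split)
  have "dfn (\<lambda>e. \<exists>x\<in>M. x = t e \<and> P (case_nat x e))"
    using assms by (intro dfn_ex dfn_conj) (simp_all add: dterm_def)
  then show ?thesis
    by (rule dfn_cong) (use assms in \<open>auto simp: dterm_M\<close>)
qed

lemma dfn_comp1: "dfn (\<lambda>e. R (e 0)) \<Longrightarrow> dterm t \<Longrightarrow> dfn (\<lambda>e. R (t e))"
  using dfn_comp_env[of "\<lambda>e. R (e 0)" t] by simp

lemma dfn_comp2:
  assumes "dfn (\<lambda>e. R (e 0) (e (Suc 0)))" "dterm t" "dterm s"
  shows "dfn (\<lambda>e. R (t e) (s e))"
proof -
  have "dfn (\<lambda>e. R (t (\<lambda>n. e (Suc n))) (e 0))"
    using dfn_comp_env[OF assms(1) dterm_subst[OF assms(2)], of Suc] by simp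
  from dfn_comp_env[OF this assms(3)] show ?thesis by simp
qed

lemma dfn_comp3:
  assumes "dfn (\<lambda>e. R (e 0) (e (Suc 0)) (e (Suc (Suc 0))))" "dterm t" "dterm s" "dterm u"
  shows "dfn (\<lambda>e. R (t e) (s e) (u e))"
proof -
  have "dfn (\<lambda>e. R (t (\<lambda>n. e (Suc (Suc n)))) (e 0) (e (Suc 0)))"
    using dfn_comp_env[OF assms(1) dterm_subst[OF assms(2)], of "\<lambda>n. Suc (Suc n)"] by simp
  from dfn_comp_env[OF this dterm_subst[OF assms(3)], of Suc]
  have "dfn (\<lambda>e. R (t (\<lambda>n. e (Suc n))) (s (\<lambda>n. e (Suc n))) (e 0))" by simp
  from dfn_comp_env[OF this assms(4)] show ?thesis by simp
qed

lemma dfn_mem: "dterm t \<Longrightarrow> dterm s \<Longrightarrow> dfn (\<lambda>e. t e \<in> elts (s e))"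
  by (rule dfn_comp2[where R="\<lambda>x y. x \<in> elts y"]) (rule dfn_mem_var)

lemma dfn_eq: "dterm t \<Longrightarrow> dterm s \<Longrightarrow> dfn (\<lambda>e. t e = s e)"
  by (rule dfn_comp2[where R="(=)"]) (rule dfn_eq_var)

lemma dfn_bex:
  assumes "dterm s" "dfn (\<lambda>e. P (\<lambda>n. e (Suc n)) (e 0))"
  shows "dfn (\<lambda>e. \<exists>x\<in>elts (s e). P e x)"
proof -
  have "dfn (\<lambda>e. \<exists>x\<in>M. x \<in> elts (s e) \<and> P e x)"
    by (intro dfn_ex dfn_conj dfn_mem dterm_var dterm_shift assms)
  then show ?thesis
    by (rule dfn_cong) (use assms(1) dterm_M trans in blast)
qed

lemma dfn_ball:
  assumes "dterm s" "dfn (\<lambda>e. P (\<lambda>n. e (Suc n)) (e 0))"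
  shows "dfn (\<lambda>e. \<forall>x\<in>elts (s e). P e x)"
  using dfn_neg[OF dfn_bex[OF assms(1) dfn_neg[OF assms(2)]]] by simp

text \<open>By extensionality in \<open>M\<close>, the graph of a set-valued operation is definable
  from its membership relation, so each new operation has to describe only its elements.\<close>

lemma dterm_set:
  assumes "\<And>e. Menv e \<Longrightarrow> t e \<in> M" "dfn (\<lambda>e. e 0 \<in> elts (t (\<lambda>n. e (Suc n))))"
  shows "dterm t"
proof -
  have "dfn (\<lambda>e. e 0 \<in> elts (t (\<lambda>n. e (Suc (Suc n)))))"
    using dfn_subst[OF assms(2), of "case_nat 0 (\<lambda>n. Suc (Suc n))"] by simp
  then have "dfn (\<lambda>e. \<forall>z\<in>M. z \<in> elts (e 0) \<longleftrightarrow> z \<in> elts (t (\<lambda>n. e (Suc n))))"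
    by (intro dfn_all dfn_iff dfn_mem_var)
  then have "dfn (\<lambda>e. e 0 = t (\<lambda>n. e (Suc n)))"
  proof (rule dfn_cong)
    fix e assume e: "Menv e"
    then have "t (\<lambda>n. e (Suc n)) \<in> M" by (rule assms(1)[OF Menv_comp])
    then show "(\<forall>z\<in>M. z \<in> elts (e 0) \<longleftrightarrow> z \<in> elts (t (\<lambda>n. e (Suc n)))) = (e 0 = t (\<lambda>n. e (Suc n)))"
      using ext_M[OF MenvD[OF e]] by simp
  qed
  then show ?thesis using assms by (simp add: dterm_def)
qed

section \<open>Closure of \<open>M\<close> under the basic set operations\<close>

lemma pair_M: "x \<in> M \<Longrightarrow> y \<in> M \<Longrightarrow> hcset {x, y} \<in> M"
proof -
  assume "x \<in> M" "y \<in> M"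
  then obtain z where z: "z \<in> M" "\<forall>u\<in>M. u \<in> elts z \<longleftrightarrow> u = x \<or> u = y"
    using bspec[OF bspec[OF zf_pairing]] by blast
  then have "elts z = {x, y}" using trans \<open>x \<in> M\<close> \<open>y \<in> M\<close> by blast
  then show ?thesis using z by (metis hcset_elts)
qed

lemma countable_Union_elts [simp]: "countable (\<Union>y\<in>elts x. elts y)"
  by (intro countable_UN) auto

definition hUnion :: "hc \<Rightarrow> hc" where
  "hUnion x = hcset (\<Union>y\<in>elts x. elts y)"

lemma elts_hUnion [simp]: "elts (hUnion x) = (\<Union>y\<in>elts x. elts y)"
  by (simp add: hUnion_def)

lemma hUnion_M: "x \<in> M \<Longrightarrow> hUnion x \<in> M"
proof -
  assume x: "x \<in> M"
  from bspec[OF zf_union x]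
  obtain z where z: "z \<in> M" and z2: "\<And>u. u \<in> M \<Longrightarrow> u \<in> elts z \<longleftrightarrow> (\<exists>y\<in>M. y \<in> elts x \<and> u \<in> elts y)"
    by blast
  have "u \<in> elts (hUnion x)" if u: "u \<in> elts z" for u
    using z2[OF trans[OF z u]] u by auto
  moreover have "u \<in> elts z" if u: "u \<in> elts (hUnion x)" for u
  proof -
    obtain y where y: "y \<in> elts x" "u \<in> elts y" using u by auto
    then have "y \<in> M" "u \<in> M" using trans x by blast+
    then show ?thesis using y z2 by blast
  qed
  ultimately have "elts z = elts (hUnion x)" by blast
  then show ?thesis using z hc_ext by metis
qed

lemma dterm_pair: "dterm t \<Longrightarrow> dterm s \<Longrightarrow> dterm (\<lambda>e. hcset {t e, s e})"
  by (rule dterm_set) (auto simp: pair_M dterm_M intro!: dfn_disj dfn_eq dterm_var dterm_shift)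

lemma dterm_single: "dterm t \<Longrightarrow> dterm (\<lambda>e. hcset {t e})"
  using dterm_pair[of t t] by simp

lemma dterm_hpair: "dterm t \<Longrightarrow> dterm s \<Longrightarrow> dterm (\<lambda>e. hpair (t e) (s e))"
  unfolding hpair_def by (intro dterm_pair dterm_single)

lemma dterm_hUnion: "dterm t \<Longrightarrow> dterm (\<lambda>e. hUnion (t e))"
  by (rule dterm_set) (auto simp: hUnion_M dterm_M intro!: dfn_bex dfn_mem dterm_var dterm_shift)

lemma separation:
  assumes "dfn (\<lambda>e. P (\<lambda>n. e (Suc n)) (e 0))" "a \<in> M" "Menv e"
  shows "hcset {x \<in> elts a. P e x} \<in> M"
proof -
  obtain \<phi> m ps where 1: "set ps \<subseteq> M" "fm_over (m + length ps) 0 \<phi>"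
    and 2: "\<And>e. Menv e \<Longrightarrow> sat M [] \<phi> (map e [0..<m] @ ps) = P (\<lambda>n. e (Suc n)) (e 0)"
    using assms by (auto simp: dfn_def)
  define f where "f i = (if i < m then i else Suc i)" for i
  have over: "fm_over (Suc (length (map e [0..<m] @ ps))) 0 (fm_rename f \<phi>)"
    using 1(2) by (rule fm_over_rename) (auto simp: f_def)
  have sat: "sat M [] (fm_rename f \<phi>) (x # map e [0..<m] @ ps) = P e x" if "x \<in> M" for x
  proof -
    have "sat M [] (fm_rename f \<phi>) (x # map e [0..<m] @ ps)
        = sat M [] \<phi> (map (case_nat x e) [0..<m] @ ps)"
      using 1 by (intro sat_rename) (auto simp: f_def nth_append nth_Cons Suc_diff_le split: nat.split)
    then show ?thesis using 2[of "case_nat x e"] that assms(3) by simp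
  qed
  have "set (map e [0..<m] @ ps) \<subseteq> M" using 1 assms(3) by (auto simp: MenvD)
  then obtain b where b: "b \<in> M" "\<forall>x\<in>M. x \<in> elts b \<longleftrightarrow> x \<in> elts a \<and> P e x"
    using zf_separation[rule_format, OF over, of a] sat assms(2) by auto
  then have "elts b = {x \<in> elts a. P e x}" using trans assms(2) by blast
  then show ?thesis using b by (metis hcset_elts)
qed

lemma collection:
  assumes "dfn (\<lambda>e. P (\<lambda>n. e (Suc (Suc n))) (e 0) (e (Suc 0)))" "a \<in> M" "Menv e"
    and ex: "\<And>x. x \<in> elts a \<Longrightarrow> \<exists>y\<in>M. P e x y"
  obtains b where "b \<in> M" "\<And>x. x \<in> elts a \<Longrightarrow> \<exists>y\<in>elts b. P e x y"
proof -
  obtain \<phi> m ps where 1: "set ps \<subseteq> M" "fm_over (m + length ps) 0 \<phi>"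
    and 2: "\<And>e. Menv e \<Longrightarrow> sat M [] \<phi> (map e [0..<m] @ ps) = P (\<lambda>n. e (Suc (Suc n))) (e 0) (e (Suc 0))"
    using assms by (auto simp: dfn_def)
  define f where "f i = (if i < m then i else Suc (Suc i))" for i
  have over: "fm_over (Suc (Suc (length (map e [0..<m] @ ps)))) 0 (fm_rename f \<phi>)"
    using 1(2) by (rule fm_over_rename) (auto simp: f_def)
  have sat: "sat M [] (fm_rename f \<phi>) (x # y # map e [0..<m] @ ps) = P e x y" if "x \<in> M" "y \<in> M" for x y
  proof -
    have "sat M [] (fm_rename f \<phi>) (x # y # map e [0..<m] @ ps)
        = sat M [] \<phi> (map (case_nat x (case_nat y e)) [0..<m] @ ps)"
      using 1 by (intro sat_rename) (auto simp: f_def nth_append nth_Cons Suc_diff_le split: nat.split)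
    then show ?thesis using 2[of "case_nat x (case_nat y e)"] that assms(3) by simp
  qed
  have ps: "set (map e [0..<m] @ ps) \<subseteq> M" using 1 assms(3) by (auto simp: MenvD)
  have ex': "\<forall>x\<in>M. x \<in> elts a \<longrightarrow> (\<exists>y\<in>M. sat M [] (fm_rename f \<phi>) (x # y # map e [0..<m] @ ps))"
    using ex sat by blast
  from mp[OF bspec[OF mp[OF mp[OF spec[OF spec[OF zf_collection]] over] ps] assms(2)] ex']
  obtain b where b: "b \<in> M"
      "\<forall>x\<in>M. x \<in> elts a \<longrightarrow> (\<exists>y\<in>M. y \<in> elts b \<and> sat M [] (fm_rename f \<phi>) (x # y # map e [0..<m] @ ps))"
    by auto
  show ?thesis
  proof (rule that[OF b(1)])
    fix x assume x: "x \<in> elts a"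
    then have "x \<in> M" using trans assms(2) by blast
    then obtain y where "y \<in> M" "y \<in> elts b" "sat M [] (fm_rename f \<phi>) (x # y # map e [0..<m] @ ps)"
      using b(2) x by blast
    then show "\<exists>y\<in>elts b. P e x y" using sat \<open>x \<in> M\<close> by blast
  qed
qed

lemma dterm_sep:
  assumes "dterm s" "dfn (\<lambda>e. P (\<lambda>n. e (Suc n)) (e 0))"
  shows "dterm (\<lambda>e. hcset {x \<in> elts (s e). P e x})"
proof (rule dterm_set)
  show "hcset {x \<in> elts (s e). P e x} \<in> M" if "Menv e" for e
    using assms that by (intro separation dterm_M)
  have "dfn (\<lambda>e. e 0 \<in> elts (s (\<lambda>n. e (Suc n))) \<and> P (\<lambda>n. e (Suc n)) (e 0))"
    by (intro dfn_conj dfn_mem dterm_var dterm_shift assms)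
  then show "dfn (\<lambda>e. e 0 \<in> elts (hcset {x \<in> elts (s (\<lambda>n. e (Suc n))). P (\<lambda>n. e (Suc n)) x}))"
    by simp
qed

text \<open>Replacement: collection bounds the values and separation cuts the bound down to the
  image. \<open>eq'\<close> swaps the two variables because \<open>collection\<close> expects the
  argument before the value.\<close>

lemma dterm_image:
  assumes "dterm s" "dterm (\<lambda>e. F (\<lambda>n. e (Suc n)) (e 0))"
  shows "dterm (\<lambda>e. hcset (F e ` elts (s e)))"
proof (rule dterm_set)
  have eq: "dfn (\<lambda>e. e 0 = F (\<lambda>n. e (Suc (Suc n))) (e (Suc 0)))"
    using assms(2) by (simp add: dterm_def)
  then have eq': "dfn (\<lambda>e. e (Suc 0) = F (\<lambda>n. e (Suc (Suc n))) (e 0))"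
    using dfn_subst[OF eq, of "case_nat (Suc 0) (case_nat 0 (\<lambda>n. Suc (Suc n)))"] by simp
  have dfn: "dfn (\<lambda>e. \<exists>x\<in>elts (s (\<lambda>n. e (Suc n))). e 0 = F (\<lambda>n. e (Suc n)) x)"
    by (rule dfn_bex[OF dterm_subst[OF assms(1)]])
      (use dfn_subst[OF eq, of "case_nat (Suc 0) (case_nat 0 (\<lambda>n. Suc (Suc n)))"] in simp)
  then show "dfn (\<lambda>e. e 0 \<in> elts (hcset (F (\<lambda>n. e (Suc n)) ` elts (s (\<lambda>n. e (Suc n))))))"
    by (simp add: image_iff)
  show "hcset (F e ` elts (s e)) \<in> M" if e: "Menv e" for e
  proof -
    have F: "F e x \<in> M" if "x \<in> elts (s e)" for x
      using dterm_M[OF assms(2), of "case_nat x e"] e that trans[OF dterm_M[OF assms(1) e]] by simp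
    obtain b where b: "b \<in> M" "\<And>x. x \<in> elts (s e) \<Longrightarrow> \<exists>y\<in>elts b. y = F e x"
      using collection[where P="\<lambda>e x y. y = F e x" and e=e and a="s e", OF eq'] F e dterm_M[OF assms(1) e] by auto
    have "hcset {y \<in> elts b. \<exists>x\<in>elts (s e). y = F e x} \<in> M"
      by (rule separation[OF dfn b(1) e])
    moreover have "{y \<in> elts b. \<exists>x\<in>elts (s e). y = F e x} = F e ` elts (s e)"
      using b(2) by force
    ultimately show ?thesis by simp
  qed
qed

lemma dfn_class:
  "X \<in> definable_classes M \<longleftrightarrow> X \<subseteq> M \<and> dfn (\<lambda>e. e 0 \<in> X)"
proof
  assume "X \<in> definable_classes M"
  then obtain \<phi> ps where 1: "X = {x \<in> M. sat M [] \<phi> (x # ps)}" "fm_over (Suc (length ps)) 0 \<phi>" "set ps \<subseteq> M"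
    by (auto simp: definable_classes_def)
  then show "X \<subseteq> M \<and> dfn (\<lambda>e. e 0 \<in> X)"
    unfolding dfn_def
    by (intro conjI exI[of _ \<phi>] exI[of _ "Suc 0"] exI[of _ ps]) (auto simp: MenvD)
next
  assume h: "X \<subseteq> M \<and> dfn (\<lambda>e. e 0 \<in> X)"
  then obtain \<phi> m ps where 1: "set ps \<subseteq> M" "fm_over (m + length ps) 0 \<phi>"
    and 2: "\<And>e. Menv e \<Longrightarrow> sat M [] \<phi> (map e [0..<m] @ ps) = (e 0 \<in> X)"
    by (auto simp: dfn_def)
  show "X \<in> definable_classes M"
  proof (cases "M = {}")
    case True
    then show ?thesis using zf_infinity by simp
  next
    case False
    then obtain c where c: "c \<in> M" by blast
    define f where "f i = (if i < m then i else Suc i)" for i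
    \<comment> \<open>Membership in \<open>X\<close> depends on \<open>e 0\<close> alone; the
      remaining variables of the formula are filled with copies of an arbitrary element
      \<open>c\<close> of \<open>M\<close>.\<close>
    define qs where "qs = replicate m c @ ps"
    have over: "fm_over (Suc (length qs)) 0 (fm_rename f \<phi>)"
      using 1(2) by (rule fm_over_rename) (auto simp: f_def qs_def)
    have "sat M [] (fm_rename f \<phi>) (x # qs) = (x \<in> X)" if "x \<in> M" for x
    proof -
      have "sat M [] (fm_rename f \<phi>) (x # qs)
          = sat M [] \<phi> (map (case_nat x (\<lambda>_. c)) [0..<m] @ ps)"
        unfolding qs_def
        using 1 by (intro sat_rename) (auto simp: f_def nth_append nth_Cons Suc_diff_le split: nat.split)
      then show ?thesis using 2[of "case_nat x (\<lambda>_. c)"] that c by simp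
    qed
    then have "X = {x \<in> M. sat M [] (fm_rename f \<phi>) (x # qs)}" using h by auto
    moreover have "set qs \<subseteq> M" using 1 c by (auto simp: qs_def)
    ultimately show ?thesis using over by (auto simp: definable_classes_def)
  qed
qed

lemma hcset_sep_M: "dfn (\<lambda>e. P (e 0)) \<Longrightarrow> a \<in> M \<Longrightarrow> hcset {x \<in> elts a. P x} \<in> M"
  using separation[of "\<lambda>e. P" a "\<lambda>_. a"] by simp

lemma hempty_M: "hempty \<in> M"
proof -
  obtain w where "w \<in> M" using zf_infinity by blast
  from hcset_sep_M[OF dfn_False this] show ?thesis by (simp add: hempty_def)
qed

section \<open>The natural numbers inside \<open>M\<close>\<close>

definition hsuc :: "hc \<Rightarrow> hc" where
  "hsuc x = hcset (insert x (elts x))"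

lemma elts_hsuc [simp]: "elts (hsuc x) = insert x (elts x)"
  by (simp add: hsuc_def)

lemma hnat_Suc_hsuc: "hnat (Suc n) = hsuc (hnat n)"
  by (simp add: hsuc_def)

lemma hinsert_eq: "hcset (insert x (elts y)) = hUnion (hcset {y, hcset {x}})"
  by (rule hc_ext) auto

lemma dterm_insert: "dterm t \<Longrightarrow> dterm s \<Longrightarrow> dterm (\<lambda>e. hcset (insert (t e) (elts (s e))))"
  unfolding hinsert_eq by (intro dterm_hUnion dterm_pair dterm_single)

lemma dterm_hsuc: "dterm t \<Longrightarrow> dterm (\<lambda>e. hsuc (t e))"
  unfolding hsuc_def by (intro dterm_insert)

lemma dterm_closed: "dterm (\<lambda>e. f (e 0)) \<Longrightarrow> x \<in> M \<Longrightarrow> f x \<in> M"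
  using dterm_M[of "\<lambda>e. f (e 0)" "\<lambda>_. x"] by simp

lemma hsuc_M: "x \<in> M \<Longrightarrow> hsuc x \<in> M"
  by (rule dterm_closed[OF dterm_hsuc[OF dterm_var]])

lemma hnat_M [simp]: "hnat n \<in> M"
proof (induction n)
  case (Suc n)
  then show ?case unfolding hnat_Suc_hsuc by (rule hsuc_M)
qed (simp add: hempty_M)

text \<open>If \<open>z = hsuc m\<close>, then \<open>m\<close> and all elements of \<open>m\<close>
  are elements of \<open>z\<close>, so the hypotheses pass to \<open>m\<close> and well-founded
  induction applies. This describes the natural numbers without quantifying over inductive
  sets.\<close>

lemma hnat_charact:
  assumes "z = hempty \<or> (\<exists>m. z = hsuc m)" "\<forall>y\<in>elts z. y = hempty \<or> (\<exists>m. y = hsuc m)"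
  shows "z \<in> range hnat"
  using assms
proof (induction z rule: hc_induct)
  case (step z)
  show ?case
  proof (cases "z = hempty")
    case True
    then show ?thesis by (metis hempty_hnat rangeI)
  next
    case False
    then obtain m where m: "z = hsuc m" using step.prems by blast
    then have "m \<in> range hnat" using step by auto
    then show ?thesis using m hnat_Suc_hsuc by (metis imageE rangeI)
  qed
qed

lemma hnat_zero_or_suc: "hnat n = hempty \<or> (\<exists>m\<in>M. hnat n = hsuc m)"
  by (cases n) (auto simp del: hnat.simps(2) simp: hnat_Suc_hsuc)

text \<open>Infinity provides only some inductive set \<open>w\<close>; the formula behind
  \<open>hnat_charact\<close> cuts \<omega> out of it.\<close>

lemma homega_M: "homega \<in> M"
proof -
  from zf_infinity obtain w where w: "w \<in> M" and zero: "\<exists>z\<in>M. z \<in> elts w \<and> (\<forall>u\<in>M. u \<notin> elts z)"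
    and succ: "\<forall>y\<in>M. y \<in> elts w \<longrightarrow> (\<exists>s\<in>M. s \<in> elts w \<and> (\<forall>u\<in>M. u \<in> elts s \<longleftrightarrow> u \<in> elts y \<or> u = y))"
    by auto
  from zero obtain z where z: "z \<in> M" "z \<in> elts w" "\<And>u. u \<in> M \<Longrightarrow> u \<notin> elts z" by blast
  have suc: "hsuc y \<in> elts w" if y: "y \<in> elts w" for y
  proof -
    obtain s where s: "s \<in> M" "s \<in> elts w" "\<forall>u\<in>M. u \<in> elts s \<longleftrightarrow> u \<in> elts y \<or> u = y"
      using mp[OF bspec[OF succ trans[OF w y]] y] by auto
    have "s = hsuc y"
      by (rule ext_M[THEN iffD1, OF s(1) hsuc_M[OF trans[OF w y]]]) (use s(3) in auto)
    then show ?thesis using s by simp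
  qed
  have nat: "hnat n \<in> elts w" for n
  proof (induction n)
    case 0
    have "elts z = {}" using z trans by blast
    then have "z = hempty" by (intro hc_ext) simp
    then show ?case using z by simp
  next
    case (Suc n)
    then show ?case unfolding hnat_Suc_hsuc by (rule suc)
  qed
  define S where "S z \<longleftrightarrow> z = hempty \<or> (\<exists>m\<in>M. z = hsuc m)" for z
  have S: "dterm t \<Longrightarrow> dfn (\<lambda>e. S (t e))" for t
    unfolding S_def by (intro dfn_disj dfn_ex dfn_eq dterm_hsuc dterm_var dterm_const hempty_M dterm_shift)
  have S_hnat: "S (hnat n)" for n
    unfolding S_def by (rule hnat_zero_or_suc)
  have "hcset {x \<in> elts w. S x \<and> (\<forall>y\<in>elts x. S y)} \<in> M"
    by (intro hcset_sep_M dfn_conj dfn_ball S dterm_var) (rule w)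
  moreover have "{x \<in> elts w. S x \<and> (\<forall>y\<in>elts x. S y)} = range hnat"
  proof (intro subset_antisym subsetI)
    fix x assume "x \<in> {x \<in> elts w. S x \<and> (\<forall>y\<in>elts x. S y)}"
    then show "x \<in> range hnat" by (intro hnat_charact) (auto simp: S_def)
  next
    fix x assume "x \<in> range hnat"
    then show "x \<in> {x \<in> elts w. S x \<and> (\<forall>y\<in>elts x. S y)}"
      using nat S_hnat by (auto simp: hnat_less)
  qed
  ultimately show ?thesis by (simp add: homega_def)
qed

lemma dfn_in_M: "dterm t \<Longrightarrow> dfn (\<lambda>e. t e \<in> M)"
  by (rule dfn_cong[OF dfn_True]) (simp add: dterm_M)

text \<open>From here on, definability is checked by following the shape of the relation with these
  rules.\<close>

lemmas dfn_intros = dfn_neg dfn_conj dfn_disj dfn_imp dfn_iff dfn_ex dfn_all dfn_True dfn_False dfn_in_M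
  dfn_mem dfn_eq dfn_bex dfn_ball dterm_var dterm_hpair dterm_single dterm_pair dterm_hsuc dterm_insert
  dterm_const[OF hempty_M] dterm_const[OF homega_M] dterm_const[OF hnat_M]

end
declare hnat.simps [simp del] elts_homega [simp del]

section \<open>Conditions and generic filters\<close>

text \<open>It makes the definable classes of a countable \<open>M\<close> countable, as the
  construction of generic filters requires.\<close>

instance fm :: countable
  by countable_datatype

context zf_model
begin

lemma hpair_M_iff: "hpair x y \<in> M \<longleftrightarrow> x \<in> M \<and> y \<in> M"
proof
  assume "hpair x y \<in> M"
  then have "hcset {x, y} \<in> M" by (rule trans) (simp add: hpair_def)
  then show "x \<in> M \<and> y \<in> M" using trans[of "hcset {x, y}"] by simp
next
  assume "x \<in> M \<and> y \<in> M"
  then show "hpair x y \<in> M" by (simp add: hpair_def pair_M pair_M[of x x, simplified])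
qed

lemma hpair_elts_M: "hpair x y \<in> elts f \<Longrightarrow> f \<in> M \<Longrightarrow> x \<in> M \<and> y \<in> M"
  using trans hpair_M_iff by blast

section \<open>Definability of the two classes of conditions\<close>

definition two :: hc where "two = hcset {hnat 0, hnat 1}"

lemma elts_two [simp]: "elts two = {hnat 0, hnat 1}"
  by (simp add: two_def)

lemma two_M: "two \<in> M"
  unfolding two_def by (intro pair_M hnat_M)

lemma hnat_0_neq_1 [simp]: "hnat 0 \<noteq> hnat (Suc 0)" "hnat (Suc 0) \<noteq> hnat 0"
  by (simp_all add: inj_eq[OF inj_hnat])

lemma omega_M: "i \<in> elts homega \<Longrightarrow> i \<in> M"
  using trans homega_M by blast

abbreviation "Pc \<equiv> P_conds M"
abbreviation "Qc \<equiv> Q_conds M"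

text \<open>All quantifiers become bounded by sets of \<open>M\<close>, so that
  \<open>dfn_intros\<close> applies. With only two possible values, being a function means not
  taking both at one argument.\<close>

lemma Pc_iff: "p \<in> Pc \<longleftrightarrow> p \<in> M \<and> (\<forall>z\<in>elts p. \<exists>k\<in>elts homega. \<exists>b\<in>elts two. z = hpair k b) \<and>
    (\<forall>k\<in>elts homega. \<not> (hpair k (hnat 0) \<in> elts p \<and> hpair k (hnat 1) \<in> elts p))"
  (is "_ \<longleftrightarrow> ?R")
proof
  assume p: "p \<in> Pc"
  have "\<exists>k\<in>elts homega. \<exists>b\<in>elts two. z = hpair k b" if z: "z \<in> elts p" for z
  proof -
    obtain k b where kb: "z = hpair k b" using p z by (auto simp: P_conds_def hfunction_def)
    then have "k \<in> hdom p" "b \<in> hran p" using z by (auto simp: hdom_def hran_def)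
    then show ?thesis using p kb by (auto simp: P_conds_def)
  qed
  moreover have "\<not> (hpair k (hnat 0) \<in> elts p \<and> hpair k (hnat 1) \<in> elts p)" for k
    using p hnat_0_neq_1[folded One_nat_def] unfolding P_conds_def hfunction_def by blast
  ultimately show ?R using p by (simp add: P_conds_def)
next
  assume R: ?R
  have b: "k \<in> elts homega \<and> b \<in> {hnat 0, hnat 1}" if "hpair k b \<in> elts p" for k b
    using bspec[OF conjunct1[OF conjunct2[OF R]] that] by auto
  have "hfunction p" unfolding hfunction_def
  proof (intro conjI ballI allI impI)
    show "\<exists>x y. z = hpair x y" if "z \<in> elts p" for z using R that by blast
    show "y = y'" if "hpair x y \<in> elts p" "hpair x y' \<in> elts p" for x y y'
      using b[OF that(1)] b[OF that(2)] R that by auto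
  qed
  then show "p \<in> Pc"
    using R b by (auto simp: P_conds_def hdom_def hran_def)
qed

lemma dfn_Pc: "dterm t \<Longrightarrow> dfn (\<lambda>e. t e \<in> Pc)"
proof (rule dfn_comp1)
  show "dfn (\<lambda>e. e 0 \<in> Pc)"
    unfolding Pc_iff by (intro dfn_intros dterm_const[OF two_M])
qed

lemma omega_bound: "finite A \<Longrightarrow> A \<subseteq> elts homega \<Longrightarrow> \<exists>n. A \<subseteq> elts (hnat n)"
proof (induction A rule: finite_induct)
  case (insert a A)
  then obtain n m where nm: "A \<subseteq> elts (hnat n)" "a = hnat m" by (auto simp: elts_homega)
  have "insert a A \<subseteq> elts (hnat (max n (Suc m)))"
    using nm by (force simp: hnat_less)
  then show ?case by blast
qed auto

lemma finite_omega: "n \<in> elts homega \<Longrightarrow> finite (elts n)"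
  by (auto simp: hnat_less elts_homega)

text \<open>Finiteness is a notion of the metatheory; inside \<open>M\<close> it is replaced by a
  bound \<open>n\<close> on the support. This is equivalent because finite sets of naturals are
  bounded and every \<open>hnat n\<close> has finitely many elements.\<close>

lemma Qc_iff: "s \<in> Qc \<longleftrightarrow> s \<in> M \<and> (\<forall>z\<in>elts s. \<exists>i\<in>elts homega. \<exists>p\<in>M. p \<in> Pc \<and> z = hpair i p) \<and>
    (\<forall>i\<in>elts homega. \<exists>p\<in>M. hpair i p \<in> elts s \<and> (\<forall>q\<in>M. hpair i q \<in> elts s \<longrightarrow> q = p)) \<and>
    (\<exists>n\<in>elts homega. \<forall>i\<in>elts homega. \<forall>p\<in>M. hpair i p \<in> elts s \<longrightarrow> p = hempty \<or> i \<in> elts n)"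
  (is "_ \<longleftrightarrow> ?M \<and> ?R1 \<and> ?R2 \<and> ?R3")
proof
  assume s: "s \<in> Qc"
  then have M: "s \<in> M" and dom: "hdom s = elts homega" and ran: "hran s \<subseteq> Pc"
    and "function": "hfunction s" and fin: "finite {i. \<exists>p. hpair i p \<in> elts s \<and> p \<noteq> hempty}"
    by (simp_all add: Q_conds_def)
  have ?R1
  proof
    fix z assume z: "z \<in> elts s"
    then obtain i p where ip: "z = hpair i p" using "function" by (auto simp: hfunction_def)
    then have "i \<in> hdom s" "p \<in> hran s" using z by (auto simp: hdom_def hran_def)
    then show "\<exists>i\<in>elts homega. \<exists>p\<in>M. p \<in> Pc \<and> z = hpair i p"
      using dom ran ip by (auto simp: P_conds_def)
  qed
  moreover have ?R2
  proof
    fix i assume "i \<in> elts homega"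
    then obtain p where p: "hpair i p \<in> elts s" using dom by (auto simp: hdom_def)
    then have "\<forall>q\<in>M. hpair i q \<in> elts s \<longrightarrow> q = p"
      using "function" unfolding hfunction_def by blast
    then show "\<exists>p\<in>M. hpair i p \<in> elts s \<and> (\<forall>q\<in>M. hpair i q \<in> elts s \<longrightarrow> q = p)"
      using p hpair_elts_M M by blast
  qed
  moreover have ?R3
  proof -
    have "{i. \<exists>p. hpair i p \<in> elts s \<and> p \<noteq> hempty} \<subseteq> elts homega"
      using dom unfolding hdom_def by blast
    then obtain n where "{i. \<exists>p. hpair i p \<in> elts s \<and> p \<noteq> hempty} \<subseteq> elts (hnat n)"
      using omega_bound[OF fin] by blast
    then show ?thesis by (intro bexI[of _ "hnat n"]) auto
  qed
  ultimately show "?M \<and> ?R1 \<and> ?R2 \<and> ?R3" using M by blast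
next
  assume R: "?M \<and> ?R1 \<and> ?R2 \<and> ?R3"
  then have M: ?M and R1: ?R1 and R2: ?R2 and R3: ?R3 by blast+
  have R1': "i \<in> elts homega \<and> p \<in> Pc \<and> p \<in> M" if "hpair i p \<in> elts s" for i p
    using bspec[OF R1 that] by auto
  have "hfunction s"
    unfolding hfunction_def
  proof (intro conjI ballI allI impI)
    show "\<exists>x y. z = hpair x y" if "z \<in> elts s" for z using bspec[OF R1 that] by blast
    show "y = y'" if h: "hpair x y \<in> elts s" "hpair x y' \<in> elts s" for x y y'
    proof -
      obtain p where "\<forall>q\<in>M. hpair x q \<in> elts s \<longrightarrow> q = p"
        using bspec[OF R2] R1'[OF h(1)] by blast
      then show ?thesis using h R1' by blast
    qed
  qed
  moreover have "hdom s = elts homega"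
  proof (intro subset_antisym subsetI)
    show "i \<in> elts homega" if "i \<in> hdom s" for i using that R1' unfolding hdom_def by blast
    show "i \<in> hdom s" if "i \<in> elts homega" for i using bspec[OF R2 that] unfolding hdom_def by blast
  qed
  moreover have "hran s \<subseteq> Pc" unfolding hran_def using R1' by blast
  moreover have "finite {i. \<exists>p. hpair i p \<in> elts s \<and> p \<noteq> hempty}"
  proof -
    obtain n where n: "n \<in> elts homega" "\<forall>i\<in>elts homega. \<forall>p\<in>M. hpair i p \<in> elts s \<longrightarrow> p = hempty \<or> i \<in> elts n"
      using R3 by blast
    have "{i. \<exists>p. hpair i p \<in> elts s \<and> p \<noteq> hempty} \<subseteq> elts n" using n(2) R1' by blast
    then show ?thesis using finite_omega[OF n(1)] finite_subset by blast
  qed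
  ultimately show "s \<in> Qc" using M by (simp add: Q_conds_def)
qed

lemma dfn_Qc: "dterm t \<Longrightarrow> dfn (\<lambda>e. t e \<in> Qc)"
proof (rule dfn_comp1)
  show "dfn (\<lambda>e. e 0 \<in> Qc)"
    unfolding Qc_iff by (intro dfn_intros dfn_Pc)
qed

lemma Qc_M: "s \<in> Qc \<Longrightarrow> s \<in> M" by (simp add: Q_conds_def)
lemma Pc_M: "p \<in> Pc \<Longrightarrow> p \<in> M" by (simp add: P_conds_def)

section \<open>Coordinates, the order of the product, and filters\<close>

definition coord :: "hc \<Rightarrow> hc \<Rightarrow> hc" where
  "coord s i = (THE p. hpair i p \<in> elts s)"

lemma coord_iff: "s \<in> Qc \<Longrightarrow> hpair i p \<in> elts s \<longleftrightarrow> i \<in> elts homega \<and> p = coord s i"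
  and coord_Pc: "s \<in> Qc \<Longrightarrow> i \<in> elts homega \<Longrightarrow> coord s i \<in> Pc"
proof -
  assume s: "s \<in> Qc"
  then have f: "p = q" if "hpair i p \<in> elts s" "hpair i q \<in> elts s" for i p q
    using that unfolding Q_conds_def hfunction_def by blast
  have ex: "i \<in> elts homega \<longleftrightarrow> (\<exists>p. hpair i p \<in> elts s)" for i
    using s unfolding Q_conds_def hdom_def by blast
  have *: "hpair i (coord s i) \<in> elts s" if "i \<in> elts homega" for i
    unfolding coord_def by (rule theI') (use f ex that in blast)
  show "hpair i p \<in> elts s \<longleftrightarrow> i \<in> elts homega \<and> p = coord s i"
    using * f ex by blast
  show "coord s i \<in> Pc" if "i \<in> elts homega"
    using *[OF that] s unfolding Q_conds_def hran_def by blast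
qed

lemma Q_le_iff: "hpair s t \<in> Q_le M \<longleftrightarrow>
    s \<in> Qc \<and> t \<in> Qc \<and> (\<forall>i\<in>elts homega. elts (coord t i) \<subseteq> elts (coord s i))"
proof -
  have le: "hpair p q \<in> P_le M \<longleftrightarrow> p \<in> Pc \<and> q \<in> Pc \<and> elts q \<subseteq> elts p" for p q
    by (auto simp: P_le_def)
  have "(\<forall>i p q. hpair i p \<in> elts s \<longrightarrow> hpair i q \<in> elts t \<longrightarrow> hpair p q \<in> P_le M) \<longleftrightarrow>
      (\<forall>i\<in>elts homega. elts (coord t i) \<subseteq> elts (coord s i))" if "s \<in> Qc" "t \<in> Qc"
    using coord_Pc[OF that(1)] coord_Pc[OF that(2)] by (simp add: coord_iff that le) blast
  moreover have "hpair s t \<in> Q_le M \<longleftrightarrow> s \<in> Qc \<and> t \<in> Qc \<and>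
      (\<forall>i p q. hpair i p \<in> elts s \<longrightarrow> hpair i q \<in> elts t \<longrightarrow> hpair p q \<in> P_le M)"
    by (simp add: Q_le_def)
  ultimately show ?thesis by blast
qed

lemma Q_le_refl: "s \<in> Qc \<Longrightarrow> hpair s s \<in> Q_le M"
  by (simp add: Q_le_iff)

lemma Q_le_trans: "hpair s t \<in> Q_le M \<Longrightarrow> hpair t u \<in> Q_le M \<Longrightarrow> hpair s u \<in> Q_le M"
  unfolding Q_le_iff by blast

text \<open>The inner \<open>elts (hcset ...)\<close> leaves the set unchanged but has the shape
  that \<open>dterm_insert\<close> and \<open>dterm_sep\<close> match; \<open>p\<close> ranges over
  \<open>M\<close> for the same reason.\<close>

definition upd_coord :: "hc \<Rightarrow> hc \<Rightarrow> hc \<Rightarrow> hc" where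
  "upd_coord s i q = hcset (insert (hpair i q) (elts (hcset {z \<in> elts s. \<forall>p\<in>M. z \<noteq> hpair i p})))"

lemma countable_sep [simp]: "countable {z \<in> elts s. R z}"
  by (rule countable_subset[of _ "elts s"]) auto

lemma elts_upd_coord [simp]: "elts (upd_coord s i q) = insert (hpair i q) {z \<in> elts s. \<forall>p\<in>M. z \<noteq> hpair i p}"
  by (simp add: upd_coord_def)

lemma dterm_upd_coord: "dterm t \<Longrightarrow> dterm u \<Longrightarrow> dterm v \<Longrightarrow> dterm (\<lambda>e. upd_coord (t e) (u e) (v e))"
  unfolding upd_coord_def by (intro dfn_intros dterm_sep) (auto intro: dfn_intros dterm_shift)

lemma upd_coord_M: "s \<in> M \<Longrightarrow> i \<in> M \<Longrightarrow> q \<in> M \<Longrightarrow> upd_coord s i q \<in> M"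
  using dterm_M[OF dterm_upd_coord[OF dterm_const dterm_const dterm_const], of s i q "\<lambda>_. s"] by simp

lemma upd_coord_Qc:
  assumes s: "s \<in> Qc" and i: "i \<in> elts homega" and q: "q \<in> Pc"
  shows "upd_coord s i q \<in> Qc" "coord (upd_coord s i q) i = q" "\<And>j. j \<in> elts homega \<Longrightarrow> j \<noteq> i \<Longrightarrow> coord (upd_coord s i q) j = coord s j"
proof -
  have mem: "hpair j p \<in> elts (upd_coord s i q) \<longleftrightarrow> j \<in> elts homega \<and> p = (if j = i then q else coord s j)" for j p
    using i hpair_elts_M[of j p s] Qc_M[OF s] by (auto simp: coord_iff[OF s])
  show *: "upd_coord s i q \<in> Qc"
    unfolding Qc_iff
  proof (intro conjI)
    show "upd_coord s i q \<in> M" using Qc_M Pc_M omega_M upd_coord_M s i q by blast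
    show "\<forall>z\<in>elts (upd_coord s i q). \<exists>i\<in>elts homega. \<exists>p\<in>M. p \<in> Pc \<and> z = hpair i p"
      using s i q Pc_M unfolding Qc_iff elts_upd_coord by blast
    show "\<forall>j\<in>elts homega. \<exists>p\<in>M. hpair j p \<in> elts (upd_coord s i q) \<and> (\<forall>qa\<in>M. hpair j qa \<in> elts (upd_coord s i q) \<longrightarrow> qa = p)"
    proof
      fix j assume j: "j \<in> elts homega"
      then have "(if j = i then q else coord s j) \<in> M" using q coord_Pc[OF s] Pc_M by auto
      then show "\<exists>p\<in>M. hpair j p \<in> elts (upd_coord s i q) \<and> (\<forall>qa\<in>M. hpair j qa \<in> elts (upd_coord s i q) \<longrightarrow> qa = p)"
        unfolding mem using j by blast
    qed
    have "finite {j. \<exists>p. hpair j p \<in> elts s \<and> p \<noteq> hempty}" using s by (simp add: Q_conds_def)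
    then have "finite (insert i {j. \<exists>p. hpair j p \<in> elts s \<and> p \<noteq> hempty})" by simp
    moreover have "insert i {j. \<exists>p. hpair j p \<in> elts s \<and> p \<noteq> hempty} \<subseteq> elts homega"
      using i by (auto simp: coord_iff[OF s])
    ultimately obtain n where n: "insert i {j. \<exists>p. hpair j p \<in> elts s \<and> p \<noteq> hempty} \<subseteq> elts (hnat n)"
      using omega_bound by blast
    then have n2: "i \<in> elts (hnat n)" "\<And>j. j \<in> elts homega \<Longrightarrow> coord s j \<noteq> hempty \<Longrightarrow> j \<in> elts (hnat n)"
      by (auto simp: coord_iff[OF s])
    show "\<exists>n\<in>elts homega. \<forall>j\<in>elts homega. \<forall>p\<in>M. hpair j p \<in> elts (upd_coord s i q) \<longrightarrow> p = hempty \<or> j \<in> elts n"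
      unfolding mem using n2 by (intro bexI[of _ "hnat n"]) auto
  qed
  show "coord (upd_coord s i q) i = q" using coord_iff[OF *, of i q] mem i by simp
  show "coord (upd_coord s i q) j = coord s j" if "j \<in> elts homega" "j \<noteq> i" for j
    using coord_iff[OF *, of j "coord s j"] mem[of j "coord s j"] that by (simp del: elts_upd_coord)
qed

lemma hempty_Pc: "hempty \<in> Pc"
  by (simp add: Pc_iff hempty_M)

definition top_cond :: hc where
  "top_cond = hcset ((\<lambda>j. hpair j hempty) ` elts homega)"

lemma elts_top_cond [simp]: "elts top_cond = (\<lambda>j. hpair j hempty) ` elts homega"
  unfolding top_cond_def by (rule elts_hcset) (intro countable_image countable_elts)

lemma top_cond_M: "top_cond \<in> M"
proof -
  have "dterm (\<lambda>e. hcset ((\<lambda>j. hpair j hempty) ` elts homega))"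
    by (intro dterm_image dfn_intros)
  from dterm_M[OF this, of "\<lambda>_. hempty"] show ?thesis by (simp add: top_cond_def hempty_M)
qed

lemma top_cond_Qc: "top_cond \<in> Qc"
  unfolding Qc_iff using top_cond_M hempty_Pc hempty_M by (auto simp: image_iff intro: hnat_omega)

lemma coord_top_cond [simp]: "i \<in> elts homega \<Longrightarrow> coord top_cond i = hempty"
  using coord_iff[OF top_cond_Qc, of i hempty] by auto

lemma Q_le_top_cond: "s \<in> Qc \<Longrightarrow> hpair s top_cond \<in> Q_le M"
  by (simp add: Q_le_iff top_cond_Qc)

lemma upd_coord_le: "s \<in> Qc \<Longrightarrow> i \<in> elts homega \<Longrightarrow> q \<in> Pc \<Longrightarrow> elts (coord s i) \<subseteq> elts q \<Longrightarrow> hpair (upd_coord s i q) s \<in> Q_le M"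
  unfolding Q_le_iff using upd_coord_Qc[of s i q] by (metis order_refl)

lemma le_single_coord: "s \<in> Qc \<Longrightarrow> i \<in> elts homega \<Longrightarrow> q \<in> Pc \<Longrightarrow> elts q \<subseteq> elts (coord s i) \<Longrightarrow> hpair s (upd_coord top_cond i q) \<in> Q_le M"
  unfolding Q_le_iff using upd_coord_Qc[OF top_cond_Qc, of i q] by (metis coord_top_cond hempty_elts empty_subsetI)

abbreviation "gen G \<equiv> generic (definable_classes M) Qc (Q_le M) G"

context
  fixes G assumes G: "gen G"
begin

lemma G_Qc: "s \<in> G \<Longrightarrow> s \<in> Qc"
  using G by (auto simp: generic_def is_filter_def)

lemma G_up: "s \<in> G \<Longrightarrow> hpair s t \<in> Q_le M \<Longrightarrow> t \<in> G"
  using G by (auto simp: generic_def is_filter_def Q_le_iff)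

lemma G_top_cond: "top_cond \<in> G"
proof -
  obtain s where "s \<in> G" using G by (auto simp: generic_def is_filter_def)
  then show ?thesis using G_up G_Qc Q_le_top_cond by blast
qed

lemma G_dir: "s \<in> G \<Longrightarrow> t \<in> G \<Longrightarrow> \<exists>r\<in>G. hpair r s \<in> Q_le M \<and> hpair r t \<in> Q_le M"
  using G unfolding generic_def is_filter_def by blast

text \<open>Genericity concerns definable dense classes only, so every density argument below
  carries a definability premise.\<close>

lemma G_dense:
  assumes "dfn (\<lambda>e. R (e 0))" "\<And>s. s \<in> Qc \<Longrightarrow> \<exists>t\<in>Qc. R t \<and> hpair t s \<in> Q_le M"
  shows "\<exists>s\<in>G. R s"
proof -
  have "{s \<in> Qc. R s} \<in> definable_classes M"
    unfolding dfn_class using dfn_conj[OF dfn_Qc[OF dterm_var] assms(1)] by (auto simp: Qc_M)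
  moreover have "is_dense Qc (Q_le M) {s \<in> Qc. R s}"
    using assms(2) unfolding is_dense_def by blast
  ultimately show ?thesis using G unfolding generic_def by blast
qed

lemma G_compat: "s \<in> G \<Longrightarrow> t \<in> G \<Longrightarrow> i \<in> elts homega \<Longrightarrow> k \<in> elts homega \<Longrightarrow>
    hpair k (hnat 0) \<in> elts (coord s i) \<Longrightarrow> hpair k (hnat 1) \<in> elts (coord t i) \<Longrightarrow> False"
proof -
  assume h: "s \<in> G" "t \<in> G" "i \<in> elts homega" "k \<in> elts homega"
    "hpair k (hnat 0) \<in> elts (coord s i)" "hpair k (hnat 1) \<in> elts (coord t i)"
  obtain r where r: "r \<in> G" "hpair r s \<in> Q_le M" "hpair r t \<in> Q_le M" using G_dir h by blast
  then have "hpair k (hnat 0) \<in> elts (coord r i)" "hpair k (hnat 1) \<in> elts (coord r i)"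
    using h unfolding Q_le_iff by blast+
  then show False using coord_Pc[OF G_Qc[OF r(1)] h(3)] h(4) unfolding Pc_iff by blast
qed

end

section \<open>Total conditions and characteristic functions\<close>

definition total_cond :: "hc \<Rightarrow> bool" where
  "total_cond p \<longleftrightarrow> (\<forall>k\<in>elts homega. hpair k (hnat 0) \<in> elts p \<or> hpair k (hnat 1) \<in> elts p)"

definition char_cond :: "hc set \<Rightarrow> hc \<Rightarrow> bool" where
  "char_cond y p \<longleftrightarrow> (\<forall>k\<in>elts homega. hpair k (hnat (if k \<in> y then 1 else 0)) \<in> elts p)"

lemma char_cond_alt: "char_cond y p \<longleftrightarrow> (\<forall>k\<in>elts homega. (k \<in> y \<longrightarrow> hpair k (hnat 1) \<in> elts p) \<and> (k \<notin> y \<longrightarrow> hpair k (hnat 0) \<in> elts p))"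
  unfolding char_cond_def by auto

lemma dfn_char_cond: "dterm t \<Longrightarrow> dterm s \<Longrightarrow> dfn (\<lambda>e. char_cond (elts (t e)) (s e))"
  by (rule dfn_comp2[where R="\<lambda>x. char_cond (elts x)"]) (auto simp: char_cond_alt intro!: dfn_intros)

lemma dfn_total_cond: "dterm t \<Longrightarrow> dfn (\<lambda>e. total_cond (t e))"
  by (rule dfn_comp1[where R=total_cond]) (auto simp: total_cond_def intro!: dfn_intros)

lemma graph_ex:
  assumes "dfn (\<lambda>e. R (e 0))"
  obtains z where "z \<in> M" "elts z = (\<lambda>k. hpair k (hnat b)) ` {k \<in> elts homega. R k}"
proof
  let ?z = "hcset ((\<lambda>k. hpair k (hnat b)) ` elts (hcset {k \<in> elts homega. R k}))"
  have "dterm (\<lambda>e. ?z)"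
    by (intro dterm_image dterm_sep dfn_intros assms)
  from dterm_M[OF this, of "\<lambda>_. hempty"] show "?z \<in> M" by (simp add: hempty_M)
  show "elts ?z = (\<lambda>k. hpair k (hnat b)) ` {k \<in> elts homega. R k}"
    by (subst elts_hcset) simp_all
qed

lemma hUn_ex:
  assumes "x \<in> M" "y \<in> M"
  obtains z where "z \<in> M" "elts z = elts x \<union> elts y"
  by (rule that[OF hUnion_M[OF pair_M[OF assms]]]) simp

text \<open>The value 0 is added wherever \<open>p\<close> does not take the value 1; where
  \<open>p\<close> already takes 0 nothing changes. The infinite extension stays in \<open>M\<close>
  by separation and replacement.\<close>

lemma total_cond_ext:
  assumes p: "p \<in> Pc"
  shows "\<exists>q\<in>Pc. elts p \<subseteq> elts q \<and> total_cond q"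
proof -
  have "dfn (\<lambda>e. hpair (e 0) (hnat 1) \<notin> elts p)"
    by (intro dfn_intros dterm_const[OF Pc_M[OF p]])
  then obtain z where z: "z \<in> M" "elts z = (\<lambda>k. hpair k (hnat 0)) ` {k \<in> elts homega. hpair k (hnat 1) \<notin> elts p}"
    by (rule graph_ex)
  obtain q where q: "q \<in> M" "elts q = elts p \<union> elts z" using hUn_ex[OF Pc_M[OF p] z(1)] .
  have "q \<in> Pc" using p q(1) unfolding Pc_iff q(2) z(2) by auto
  moreover have "total_cond q" unfolding total_cond_def q z by auto
  ultimately show ?thesis using q by blast
qed

lemma char_cond_ex:
  assumes y: "y \<in> M"
  shows "\<exists>p\<in>Pc. char_cond (elts y) p"
proof -
  have y1: "dfn (\<lambda>e. e 0 \<in> elts y)" and y0: "dfn (\<lambda>e. e 0 \<notin> elts y)"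
    by (intro dfn_intros dterm_const[OF y])+
  obtain p1 where p1: "p1 \<in> M" "elts p1 = (\<lambda>k. hpair k (hnat 1)) ` {k \<in> elts homega. k \<in> elts y}"
    using y1 by (rule graph_ex)
  obtain p0 where p0: "p0 \<in> M" "elts p0 = (\<lambda>k. hpair k (hnat 0)) ` {k \<in> elts homega. k \<notin> elts y}"
    using y0 by (rule graph_ex)
  note p = p1 p0
  obtain q where q: "q \<in> M" "elts q = elts p0 \<union> elts p1" using hUn_ex[OF p(3,1)] .
  have "q \<in> Pc" using q(1) unfolding Pc_iff q(2) p(2,4) by auto
  moreover have "char_cond (elts y) q" unfolding char_cond_alt q p by auto
  ultimately show ?thesis by blast
qed

lemma char_cond_mem:
  assumes "char_cond y p" "p \<in> Pc" "k \<in> elts homega"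
  shows "hpair k (hnat 1) \<in> elts p \<longleftrightarrow> k \<in> y" "hpair k (hnat 0) \<in> elts p \<longleftrightarrow> k \<notin> y"
  using assms unfolding char_cond_alt Pc_iff by blast+

text \<open>A one-point condition decides a single digit of a single real. Apart from
  \<open>top_cond\<close>, these are the only conditions used in the names built below.\<close>

definition bit :: "hc \<Rightarrow> hc \<Rightarrow> nat \<Rightarrow> hc" where
  "bit i k b = upd_coord top_cond i (hcset {hpair k (hnat b)})"

lemma bit_Pc: "k \<in> elts homega \<Longrightarrow> b \<in> {0, 1} \<Longrightarrow> hcset {hpair k (hnat b)} \<in> Pc"
  unfolding Pc_iff using pair_M[of "hpair k (hnat b)" "hpair k (hnat b)"] hpair_M_iff omega_M by auto

lemma bit_Qc: "i \<in> elts homega \<Longrightarrow> k \<in> elts homega \<Longrightarrow> b \<in> {0, 1} \<Longrightarrow> bit i k b \<in> Qc"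
  unfolding bit_def by (intro upd_coord_Qc top_cond_Qc bit_Pc)

definition real_at :: "hc set \<Rightarrow> hc \<Rightarrow> hc set" where
  "real_at G i = {k \<in> elts homega. bit i k 1 \<in> G}"

section \<open>The sequence of reals of a generic filter\<close>

context
  fixes G assumes G: "gen G"
begin

lemma bit_G:
  assumes "i \<in> elts homega" "k \<in> elts homega" "b \<in> {0, 1}"
  shows "bit i k b \<in> G \<longleftrightarrow> (\<exists>s\<in>G. hpair k (hnat b) \<in> elts (coord s i))"
proof
  assume "bit i k b \<in> G"
  moreover have "coord (bit i k b) i = hcset {hpair k (hnat b)}"
    unfolding bit_def by (intro upd_coord_Qc top_cond_Qc bit_Pc assms)
  ultimately show "\<exists>s\<in>G. hpair k (hnat b) \<in> elts (coord s i)" by force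
next
  assume "\<exists>s\<in>G. hpair k (hnat b) \<in> elts (coord s i)"
  then obtain s where s: "s \<in> G" "hpair k (hnat b) \<in> elts (coord s i)" by blast
  have "hpair s (bit i k b) \<in> Q_le M"
    unfolding bit_def by (rule le_single_coord) (use G_Qc[OF G] s assms in \<open>auto intro: bit_Pc\<close>)
  then show "bit i k b \<in> G" using G_up[OF G s(1)] by blast
qed

lemma G_total:
  assumes i: "i \<in> elts homega"
  shows "\<exists>s\<in>G. total_cond (coord s i)"
proof -
  \<comment> \<open>The coordinate is quantified here, because \<open>coord\<close> is a definite
    description while the dense class must be written in a form that \<open>dfn_intros\<close> can
    follow.\<close>
  have "\<exists>s\<in>G. \<exists>p\<in>M. hpair i p \<in> elts s \<and> total_cond p"
  proof (rule G_dense[OF G])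
    show "dfn (\<lambda>e. \<exists>p\<in>M. hpair i p \<in> elts (e 0) \<and> total_cond p)"
      by (intro dfn_intros dfn_total_cond dterm_const[OF omega_M[OF i]])
    fix s assume s: "s \<in> Qc"
    obtain q where q: "q \<in> Pc" "elts (coord s i) \<subseteq> elts q" "total_cond q"
      using total_cond_ext[OF coord_Pc[OF s i]] by blast
    have "hpair i q \<in> elts (upd_coord s i q)" by simp
    then show "\<exists>t\<in>Qc. (\<exists>p\<in>M. hpair i p \<in> elts t \<and> total_cond p) \<and> hpair t s \<in> Q_le M"
      using q upd_coord_Qc(1)[OF s i q(1)] upd_coord_le[OF s i q(1,2)] Pc_M by blast
  qed
  then obtain s p where s: "s \<in> G" "hpair i p \<in> elts s" "total_cond p" by blast
  then have "p = coord s i" using coord_iff[OF G_Qc[OF G s(1)]] by simp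
  then show ?thesis using s by blast
qed

lemma real_at_char_cond:
  assumes i: "i \<in> elts homega" and s: "s \<in> G" and char_cond: "char_cond y (coord s i)" and y: "y \<subseteq> elts homega"
  shows "real_at G i = y"
proof -
  have P: "coord s i \<in> Pc" using coord_Pc G_Qc[OF G s] i by blast
  have "bit i k 1 \<in> G \<longleftrightarrow> k \<in> y" if k: "k \<in> elts homega" for k
  proof
    assume "bit i k 1 \<in> G"
    then obtain t where t: "t \<in> G" "hpair k (hnat 1) \<in> elts (coord t i)" using bit_G[OF i k, of 1] by auto
    show "k \<in> y"
    proof (rule ccontr)
      assume "k \<notin> y"
      then show False using G_compat[OF G s t(1) i k _ t(2)] char_cond_mem(2)[OF char_cond P k] by blast
    qed
  next
    assume "k \<in> y"
    then show "bit i k 1 \<in> G" using bit_G[OF i k, of 1] char_cond_mem(1)[OF char_cond P k] s by auto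
  qed
  then show ?thesis using y unfolding real_at_def by auto
qed

text \<open>Since some condition in \<open>G\<close> is total at \<open>i\<close>, absence of a
  digit is witnessed by a condition just as its presence is. Thus the negation of an atomic
  statement also gets a name at level 0.\<close>

lemma bit0_G:
  assumes i: "i \<in> elts homega" and k: "k \<in> elts homega"
  shows "bit i k 0 \<in> G \<longleftrightarrow> k \<notin> real_at G i"
proof -
  obtain s where s: "s \<in> G" "total_cond (coord s i)" using G_total[OF i] by blast
  then show ?thesis
    using bit_G[OF i k, of 0] bit_G[OF i k, of 1] k G_compat[OF G _ _ i k]
    unfolding total_cond_def real_at_def by (auto simp: One_nat_def[symmetric] simp del: One_nat_def)
qed

lemma real_at_M:
  assumes i: "i \<in> elts homega"
  shows "\<exists>y\<in>M. elts y = real_at G i"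
proof -
  obtain s where s: "s \<in> G" "total_cond (coord s i)" using G_total[OF i] by blast
  define y where "y = hcset {k \<in> elts homega. hpair k (hnat 1) \<in> elts (coord s i)}"
  have P: "coord s i \<in> Pc" using coord_Pc G_Qc[OF G s(1)] i by blast
  have "y \<in> M" unfolding y_def
    by (intro hcset_sep_M dfn_intros dterm_const[OF Pc_M[OF P]] homega_M)
  moreover have "char_cond (elts y) (coord s i)" using s(2) unfolding char_cond_alt total_cond_def y_def by auto
  ultimately show ?thesis using real_at_char_cond[OF i s(1), of "elts y"] by (intro bexI[of _ y]) (auto simp: y_def)
qed

lemma real_at_surj:
  assumes y: "y \<in> M" "elts y \<subseteq> elts homega"
  shows "\<exists>i\<in>elts homega. real_at G i = elts y"
proof -
  have "\<exists>s\<in>G. \<exists>i\<in>elts homega. \<exists>p\<in>M. hpair i p \<in> elts s \<and> char_cond (elts y) p"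
  proof (rule G_dense[OF G])
    show "dfn (\<lambda>e. \<exists>i\<in>elts homega. \<exists>p\<in>M. hpair i p \<in> elts (e 0) \<and> char_cond (elts y) p)"
      by (intro dfn_intros dfn_char_cond dterm_const[OF y(1)])
    fix s assume s: "s \<in> Qc"
    then obtain n where n: "n \<in> elts homega" "\<forall>i\<in>elts homega. \<forall>p\<in>M. hpair i p \<in> elts s \<longrightarrow> p = hempty \<or> i \<in> elts n"
      unfolding Qc_iff by blast
    \<comment> \<open>\<open>n\<close> bounds the support and \<open>n \<notin> elts n\<close>, so
      coordinate \<open>n\<close> is free to receive any real.\<close>
    then have "coord s n = hempty"
      using coord_iff[OF s, of n "coord s n"] Pc_M[OF coord_Pc[OF s, of n]] not_mem_self by blast
    obtain q where q: "q \<in> Pc" "char_cond (elts y) q" using char_cond_ex[OF y(1)] by blast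
    have "hpair n q \<in> elts (upd_coord s n q)" by simp
    then show "\<exists>t\<in>Qc. (\<exists>i\<in>elts homega. \<exists>p\<in>M. hpair i p \<in> elts t \<and> char_cond (elts y) p) \<and> hpair t s \<in> Q_le M"
      using q upd_coord_Qc(1)[OF s n(1) q(1)] upd_coord_le[OF s n(1) q(1)] Pc_M n(1) \<open>coord s n = hempty\<close> by force
  qed
  then obtain s i p where s: "s \<in> G" "i \<in> elts homega" "hpair i p \<in> elts s" "char_cond (elts y) p" by blast
  then have "p = coord s i" using coord_iff[OF G_Qc[OF G s(1)]] by simp
  then show ?thesis using real_at_char_cond[OF s(2,1) _ y(2)] s by blast
qed

end

text \<open>The Rasiowa-Sikorski construction: \<open>d\<close> descends through an enumeration of
  the dense classes, and \<open>G\<close> is the upward closure of \<open>d\<close>.\<close>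

lemma generic_ex:
  assumes M: "countable M" and p: "p \<in> Qc"
  shows "\<exists>G. gen G \<and> p \<in> G"
proof -
  have "definable_classes M \<subseteq> (\<lambda>(\<phi>, ps). {x \<in> M. sat M [] \<phi> (x # ps)}) ` (UNIV \<times> lists M)"
    unfolding definable_classes_def by auto
  then have "countable (definable_classes M)"
    by (rule countable_subset) (intro countable_image countable_SIGMA countable_lists M countableI_type)
  \<comment> \<open>Inserting \<open>Qc\<close> makes the family visibly nonempty, as
    \<open>from_nat_into\<close> requires.\<close>
  then have cD: "countable (insert Qc {D \<in> definable_classes M. is_dense Qc (Q_le M) D})" (is "countable ?D")
    by (simp add: countable_Collect)
  have dense: "is_dense Qc (Q_le M) D" if "D \<in> ?D" for D
    using that Q_le_refl unfolding is_dense_def by auto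
  define D where "D = from_nat_into ?D"
  have D: "D n \<in> ?D" for n unfolding D_def by (rule from_nat_into) simp
  define d where "d = rec_nat p (\<lambda>n s. SOME t. t \<in> D n \<and> hpair t s \<in> Q_le M)"
  have d0: "d 0 = p" by (simp add: d_def)
  have dS: "d (Suc n) \<in> D n \<and> hpair (d (Suc n)) (d n) \<in> Q_le M \<and> d n \<in> Qc" for n
  proof (induction n)
    case 0
    have "\<exists>t. t \<in> D 0 \<and> hpair t p \<in> Q_le M" using dense[OF D[of 0]] p unfolding is_dense_def by blast
    from someI_ex[OF this] show ?case using p by (simp add: d_def)
  next
    case (Suc n)
    then have Q: "d (Suc n) \<in> Qc" by (simp add: Q_le_iff)
    have "\<exists>t. t \<in> D (Suc n) \<and> hpair t (d (Suc n)) \<in> Q_le M" using dense[OF D[of "Suc n"]] Q unfolding is_dense_def by blast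
    from someI_ex[OF this] show ?case using Q by (simp add: d_def)
  qed
  have mono: "hpair (d (n + m)) (d n) \<in> Q_le M" for n m
  proof (induction m)
    case 0
    then show ?case using dS Q_le_refl by simp
  next
    case (Suc m)
    then show ?case using dS[of "n + m"] Q_le_trans by auto
  qed
  define G where "G = {q \<in> Qc. \<exists>n. hpair (d n) q \<in> Q_le M}"
  have dG: "d n \<in> G" for n unfolding G_def using dS Q_le_refl by blast
  have "is_filter Qc (Q_le M) G"
    unfolding is_filter_def
  proof (intro conjI ballI impI)
    show "G \<subseteq> Qc" by (auto simp: G_def)
    show "G \<noteq> {}" using dG by blast
    show "q \<in> G" if "p \<in> G" "q \<in> Qc" "hpair p q \<in> Q_le M" for p q
      using that Q_le_trans unfolding G_def by blast
    fix q r assume "q \<in> G" "r \<in> G"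
    then obtain n m where nm: "hpair (d n) q \<in> Q_le M" "hpair (d m) r \<in> Q_le M" unfolding G_def by blast
    then have "hpair (d (n + m)) q \<in> Q_le M" "hpair (d (n + m)) r \<in> Q_le M"
      using Q_le_trans[OF mono[of n m] nm(1)] Q_le_trans[OF mono[of m n] nm(2)] by (simp_all add: add.commute)
    then show "\<exists>u\<in>G. hpair u q \<in> Q_le M \<and> hpair u r \<in> Q_le M" using dG by blast
  qed
  moreover have "G \<inter> X \<noteq> {}" if "X \<in> definable_classes M" "is_dense Qc (Q_le M) X" for X
  proof -
    have "X \<in> ?D" using that by blast
    then obtain n where "D n = X" unfolding D_def using from_nat_into_surj[OF cD] by metis
    then show ?thesis using dS[of n] dG[of "Suc n"] by blast
  qed
  ultimately have "gen G" unfolding generic_def by blast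
  then show ?thesis using dG[of 0] d0 by auto
qed

end

section \<open>Names for infinitary Boolean combinations\<close>

lemma case_nat_eta [simp]: "case_nat (e 0) (\<lambda>n. e (Suc n)) = e"
  by (rule ext) (simp split: nat.split)

text \<open>\<open>hcset\<close> behaves as intended only on countable sets, so the set of relevant
  \<tau> is first placed inside the image of the countable set \<open>elts \<sigma>\<close> under
  the first projection.\<close>

lemma elts_name_val: "elts (name_val G \<sigma>) = name_val G ` {\<tau>. \<exists>p\<in>G. hpair \<tau> p \<in> elts \<sigma>}"
proof -
  have [simp]: "(THE \<tau>. \<exists>q. hpair x p = hpair \<tau> q) = x" for x p
    by (rule the_equality) auto
  have "{\<tau>. \<exists>p\<in>G. hpair \<tau> p \<in> elts \<sigma>} \<subseteq> (\<lambda>z. THE \<tau>. \<exists>p. z = hpair \<tau> p) ` elts \<sigma>"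
    by (force simp: image_iff simp del: hpair_inject)
  then have "countable {\<tau>. \<exists>p\<in>G. hpair \<tau> p \<in> elts \<sigma>}"
    by (rule countable_subset) simp
  then show ?thesis by (subst name_val.simps) simp
qed

lemma name_val_hempty [simp]: "name_val G hempty = hempty"
  by (rule hc_ext) (simp add: elts_name_val)

section \<open>Names for truth values\<close>

context zf_model
begin

text \<open>The weakest condition lies in every generic filter, so evaluation commutes with this
  formation of sets; any dependence on \<open>G\<close> sits in the elements.\<close>

definition mkname :: "hc \<Rightarrow> hc" where
  "mkname A = hcset ((\<lambda>\<tau>. hpair \<tau> top_cond) ` elts A)"

lemma elts_mkname: "elts (mkname A) = (\<lambda>\<tau>. hpair \<tau> top_cond) ` elts A"
  by (simp add: mkname_def)

lemma elts_name_val_mkname: "top_cond \<in> G \<Longrightarrow> elts (name_val G (mkname A)) = name_val G ` elts A"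
  by (auto simp: elts_name_val elts_mkname)

text \<open>
  The truth values change with the level so that a NOR becomes the mere formation of a set: for a
  family of values \<open>tv n (b i)\<close>, the set \<open>{tv n False} \<union> {tv n (b i) | i}\<close> is \<open>tv (Suc n) (\<forall>i. \<not> b i)\<close>.
\<close>

primrec tv :: "nat \<Rightarrow> bool \<Rightarrow> hc" where
  "tv 0 b = (if b then hcset {hempty} else hempty)"
| "tv (Suc n) b = hcset (if b then {tv n False} else {tv n False, tv n True})"

primrec tv_name :: "nat \<Rightarrow> bool \<Rightarrow> hc" where
  "tv_name 0 b = (if b then mkname (hcset {hempty}) else hempty)"
| "tv_name (Suc n) b = mkname (hcset (if b then {tv_name n False} else {tv_name n False, tv_name n True}))"

lemma tv_inj: "tv n True \<noteq> tv n False"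
proof (induction n)
  case 0
  then show ?case by (metis tv.simps(1) elts_hcset hempty_elts countable_empty countable_insert insert_not_empty)
next
  case (Suc n)
  then show ?case by (auto simp: hcset_inject)
qed

lemma name_val_tv_name: "top_cond \<in> G \<Longrightarrow> name_val G (tv_name n b) = tv n b"
proof (induction n arbitrary: b)
  case 0
  then show ?case by (auto intro!: hc_ext simp: elts_name_val_mkname)
next
  case (Suc n)
  then show ?case by (auto intro!: hc_ext simp: elts_name_val_mkname)
qed

lemma is_name_mkname: "(\<And>\<tau>. \<tau> \<in> elts A \<Longrightarrow> is_name Qc \<tau>) \<Longrightarrow> is_name Qc (mkname A)"
  by (rule is_name.intros) (use top_cond_Qc in \<open>auto simp: elts_mkname\<close>)

lemma is_name_hempty: "is_name Qc hempty"
  by (rule is_name.intros) simp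

lemma is_name_tv_name: "is_name Qc (tv_name n b)"
  by (induction n arbitrary: b) (auto intro!: is_name_mkname is_name_hempty)

lemma dterm_mkname: "dterm t \<Longrightarrow> dterm (\<lambda>e. mkname (t e))"
  unfolding mkname_def by (intro dterm_image dfn_intros dterm_const[OF top_cond_M])

lemma mkname_M: "A \<in> M \<Longrightarrow> mkname A \<in> M"
  by (rule dterm_closed[OF dterm_mkname[OF dterm_var]])

lemma tv_name_M: "tv_name n b \<in> M"
  by (induction n arbitrary: b) (auto intro!: mkname_M pair_M pair_M[of x x for x, simplified] hempty_M)

text \<open>The variables of a name stand for positions and digits of the generic sequence, and
  \<open>bit\<close> yields a condition only at natural numbers.\<close>

definition omega_env :: "(nat \<Rightarrow> hc) \<Rightarrow> bool" where
  "omega_env e \<longleftrightarrow> (\<forall>k. e k \<in> elts homega)"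

lemma omega_env_Menv: "omega_env e \<Longrightarrow> Menv e"
  by (simp add: omega_env_def Menv_def omega_M)

lemma omega_env_case_nat [simp]: "omega_env (case_nat i e) \<longleftrightarrow> i \<in> elts homega \<and> omega_env e"
  unfolding omega_env_def by (metis old.nat.simps(4,5) not0_implies_Suc)

lemma omega_env_comp: "omega_env e \<Longrightarrow> omega_env (\<lambda>k. e (r k))"
  by (simp add: omega_env_def)

lemma omega_envD: "omega_env e \<Longrightarrow> e k \<in> elts homega"
  by (simp add: omega_env_def)

text \<open>The name must be a definable term in the indices, not merely exist for each
  \<open>e\<close>: \<open>rep_at_all\<close> gathers the names of all instances into one set of
  \<open>M\<close> by replacement.\<close>

definition rep_at :: "nat \<Rightarrow> (hc set \<Rightarrow> (nat \<Rightarrow> hc) \<Rightarrow> bool) \<Rightarrow> bool" where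
  "rep_at n B \<longleftrightarrow> (\<exists>N. dterm N \<and> (\<forall>e. omega_env e \<longrightarrow> is_name Qc (N e) \<and>
     (\<forall>G. gen G \<longrightarrow> name_val G (N e) = tv n (B G e))))"

lemma rep_at_cong:
  assumes "rep_at n B" "\<And>G e. gen G \<Longrightarrow> omega_env e \<Longrightarrow> B G e = B' G e"
  shows "rep_at n B'"
proof -
  obtain N where "dterm N" "\<And>e. omega_env e \<Longrightarrow> is_name Qc (N e) \<and> (\<forall>G. gen G \<longrightarrow> name_val G (N e) = tv n (B G e))"
    using assms unfolding rep_at_def by blast
  then show ?thesis unfolding rep_at_def using assms(2) by (intro exI[of _ N]) auto
qed

lemma rep_at_subst:
  assumes "rep_at n B"
  shows "rep_at n (\<lambda>G e. B G (\<lambda>k. e (r k)))"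
proof -
  obtain N where N: "dterm N" "\<And>e. omega_env e \<Longrightarrow> is_name Qc (N e) \<and> (\<forall>G. gen G \<longrightarrow> name_val G (N e) = tv n (B G e))"
    using assms unfolding rep_at_def by blast
  show ?thesis unfolding rep_at_def
  proof (intro exI[of _ "\<lambda>e. N (\<lambda>k. e (r k))"] conjI[OF dterm_subst[OF N(1)]] allI impI)
    fix e assume "omega_env e"
    show "is_name Qc (N (\<lambda>k. e (r k))) \<and> (\<forall>G. gen G \<longrightarrow> name_val G (N (\<lambda>k. e (r k))) = tv n (B G (\<lambda>k. e (r k))))"
      by (rule N(2)[OF omega_env_comp[OF \<open>omega_env e\<close>]])
  qed
qed

lemma rep_at_nor:
  assumes "rep_at n B1" "rep_at n B2"
  shows "rep_at (Suc n) (\<lambda>G e. \<not> B1 G e \<and> \<not> B2 G e)"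
proof -
  obtain N1 where N1: "dterm N1" "\<And>e. omega_env e \<Longrightarrow> is_name Qc (N1 e)"
    "\<And>e G. omega_env e \<Longrightarrow> gen G \<Longrightarrow> name_val G (N1 e) = tv n (B1 G e)"
    using assms(1) unfolding rep_at_def by blast
  obtain N2 where N2: "dterm N2" "\<And>e. omega_env e \<Longrightarrow> is_name Qc (N2 e)"
    "\<And>e G. omega_env e \<Longrightarrow> gen G \<Longrightarrow> name_val G (N2 e) = tv n (B2 G e)"
    using assms(2) unfolding rep_at_def by blast
  define N where "N e = mkname (hcset (insert (tv_name n False) (elts (hcset {N1 e, N2 e}))))" for e
  have "dterm N" unfolding N_def
    by (intro dterm_mkname dfn_intros N1(1) N2(1) dterm_const[OF tv_name_M])
  moreover have "is_name Qc (N e)" if "omega_env e" for e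
    unfolding N_def by (rule is_name_mkname) (use N1(2) N2(2) that in \<open>auto simp: is_name_tv_name\<close>)
  moreover have "name_val G (N e) = tv (Suc n) (\<not> B1 G e \<and> \<not> B2 G e)" if e: "omega_env e" and G: "gen G" for e G
  proof (rule hc_ext)
    have "elts (name_val G (N e)) = {tv n False, tv n (B1 G e), tv n (B2 G e)}"
      unfolding N_def elts_name_val_mkname[OF G_top_cond[OF G]]
      by (simp add: name_val_tv_name G_top_cond[OF G] N1(3) N2(3) e G)
    then show "elts (name_val G (N e)) = elts (tv (Suc n) (\<not> B1 G e \<and> \<not> B2 G e))"
      by (cases "B1 G e"; cases "B2 G e") auto
  qed
  ultimately show ?thesis unfolding rep_at_def by blast
qed

lemma rep_at_all:
  assumes "rep_at n (\<lambda>G e. B G (\<lambda>n. e (Suc n)) (e 0))"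
  shows "rep_at (Suc n) (\<lambda>G e. \<forall>i\<in>elts homega. \<not> B G e i)"
proof -
  obtain N1 where N1: "dterm N1" "\<And>e. omega_env e \<Longrightarrow> is_name Qc (N1 e)"
    "\<And>e G. omega_env e \<Longrightarrow> gen G \<Longrightarrow> name_val G (N1 e) = tv n (B G (\<lambda>n. e (Suc n)) (e 0))"
    using assms(1) unfolding rep_at_def by blast
  define N where "N e = mkname (hcset (insert (tv_name n False) (elts (hcset ((\<lambda>i. N1 (case_nat i e)) ` elts homega)))))" for e
  have "dterm N" unfolding N_def
    by (intro dterm_mkname dfn_intros dterm_image dterm_const[OF tv_name_M]) (simp add: N1(1))
  moreover have "is_name Qc (N e)" if "omega_env e" for e
    unfolding N_def by (rule is_name_mkname) (use N1(2) that in \<open>auto simp: is_name_tv_name\<close>)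
  moreover have "name_val G (N e) = tv (Suc n) (\<forall>i\<in>elts homega. \<not> B G e i)" if e: "omega_env e" and G: "gen G" for e G
  proof (rule hc_ext)
    have "name_val G ` (\<lambda>i. N1 (case_nat i e)) ` elts homega = (\<lambda>i. tv n (B G e i)) ` elts homega"
      unfolding image_image by (rule image_cong[OF refl]) (simp add: N1(3) e G)
    then have "elts (name_val G (N e)) = insert (tv n False) ((\<lambda>i. tv n (B G e i)) ` elts homega)"
      unfolding N_def elts_name_val_mkname[OF G_top_cond[OF G]]
      by (simp add: name_val_tv_name G_top_cond[OF G])
    also have "\<dots> = elts (tv (Suc n) (\<forall>i\<in>elts homega. \<not> B G e i))"
    proof (cases "\<forall>i\<in>elts homega. \<not> B G e i")
      case True
      then show ?thesis by auto
    next
      case False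
      then obtain i where i: "i \<in> elts homega" "B G e i" by blast
      have "tv n b \<in> {tv n False, tv n True}" for b by (cases b) auto
      moreover have "tv n True \<in> (\<lambda>i. tv n (B G e i)) ` elts homega"
        using i by (intro image_eqI[of _ _ i]) auto
      ultimately have "insert (tv n False) ((\<lambda>i. tv n (B G e i)) ` elts homega) = {tv n False, tv n True}"
        by blast
      then show ?thesis using i by auto
    qed
    finally show "elts (name_val G (N e)) = elts (tv (Suc n) (\<forall>i\<in>elts homega. \<not> B G e i))" .
  qed
  ultimately show ?thesis unfolding rep_at_def by blast
qed

text \<open>
  Negation raises the level by one.  Having names at all large levels allows to combine two
  statements whose names would otherwise live at levels of different parity.
\<close>

definition rep :: "(hc set \<Rightarrow> (nat \<Rightarrow> hc) \<Rightarrow> bool) \<Rightarrow> bool" where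
  "rep B \<longleftrightarrow> (\<exists>n0. \<forall>n\<ge>n0. rep_at n B)"

lemma rep_cong: "rep B \<Longrightarrow> (\<And>G e. gen G \<Longrightarrow> omega_env e \<Longrightarrow> B G e = B' G e) \<Longrightarrow> rep B'"
  unfolding rep_def using rep_at_cong by blast

lemma rep_subst: "rep B \<Longrightarrow> rep (\<lambda>G e. B G (\<lambda>k. e (r k)))"
  unfolding rep_def using rep_at_subst by blast

lemma rep_SucI: "(\<exists>n0. \<forall>n\<ge>n0. rep_at (Suc n) B) \<Longrightarrow> rep B"
  unfolding rep_def by (metis Suc_le_D Suc_le_mono)

lemma rep_nor: "rep B1 \<Longrightarrow> rep B2 \<Longrightarrow> rep (\<lambda>G e. \<not> B1 G e \<and> \<not> B2 G e)"
proof (rule rep_SucI)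
  assume "rep B1" "rep B2"
  then obtain n1 n2 where "\<forall>n\<ge>n1. rep_at n B1" "\<forall>n\<ge>n2. rep_at n B2" unfolding rep_def by blast
  then show "\<exists>n0. \<forall>n\<ge>n0. rep_at (Suc n) (\<lambda>G e. \<not> B1 G e \<and> \<not> B2 G e)"
    by (intro exI[of _ "max n1 n2"]) (auto intro: rep_at_nor)
qed

lemma rep_not: "rep B \<Longrightarrow> rep (\<lambda>G e. \<not> B G e)"
  using rep_nor[of B B] by simp

lemma rep_conj: "rep B1 \<Longrightarrow> rep B2 \<Longrightarrow> rep (\<lambda>G e. B1 G e \<and> B2 G e)"
  using rep_nor[OF rep_not[of B1] rep_not[of B2]] by simp

lemma rep_imp: "rep B1 \<Longrightarrow> rep B2 \<Longrightarrow> rep (\<lambda>G e. B1 G e \<longrightarrow> B2 G e)"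
  using rep_not[OF rep_conj[OF _ rep_not[of B2]], of B1] by simp

lemma rep_iff: "rep B1 \<Longrightarrow> rep B2 \<Longrightarrow> rep (\<lambda>G e. B1 G e \<longleftrightarrow> B2 G e)"
  unfolding iff_conv_conj_imp by (intro rep_conj rep_imp)

lemma rep_all:
  assumes "rep (\<lambda>G e. B G (\<lambda>n. e (Suc n)) (e 0))"
  shows "rep (\<lambda>G e. \<forall>i\<in>elts homega. B G e i)"
proof (rule rep_SucI)
  obtain n0 where "\<forall>n\<ge>n0. rep_at n (\<lambda>G e. \<not> B G (\<lambda>n. e (Suc n)) (e 0))"
    using rep_not[OF assms] unfolding rep_def by blast
  then show "\<exists>n0. \<forall>n\<ge>n0. rep_at (Suc n) (\<lambda>G e. \<forall>i\<in>elts homega. B G e i)"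
    using rep_at_all[where B="\<lambda>G e i. \<not> B G e i"] by auto
qed

lemma rep_ex:
  assumes "rep (\<lambda>G e. B G (\<lambda>n. e (Suc n)) (e 0))"
  shows "rep (\<lambda>G e. \<exists>i\<in>elts homega. B G e i)"
  using rep_not[OF rep_all[OF rep_not[OF assms]]] by simp

text \<open>
  A negated atom is not a NOR at level 0, hence both an atom and its negation are needed to start.
\<close>

lemma rep_from_0:
  assumes "rep_at 0 B" "rep_at 0 (\<lambda>G e. \<not> B G e)"
  shows "rep B"
proof -
  have "rep_at n B \<and> rep_at n (\<lambda>G e. \<not> B G e)" for n
  proof (induction n)
    case (Suc n)
    then show ?case using rep_at_nor[of n B B] rep_at_nor[of n "\<lambda>G e. \<not> B G e" "\<lambda>G e. \<not> B G e"] by simp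
  qed (use assms in blast)
  then show ?thesis unfolding rep_def by blast
qed

text \<open>The only possible element, the empty set, enters the value exactly when the condition
  lies in \<open>G\<close>; hence the choice of \<emptyset> and {\<emptyset>} as truth values at
  level 0.\<close>

lemma rep_at_0_single:
  assumes "dterm t" "\<And>e. omega_env e \<Longrightarrow> t e \<in> Qc"
  shows "rep_at 0 (\<lambda>G e. t e \<in> G)"
proof -
  define N where "N e = hcset {hpair hempty (t e)}" for e
  have "dterm N" unfolding N_def by (intro dfn_intros assms(1))
  moreover have "is_name Qc (N e)" if "omega_env e" for e
    by (rule is_name.intros) (use assms(2)[OF that] is_name_hempty in \<open>auto simp: N_def\<close>)
  moreover have "name_val G (N e) = tv 0 (t e \<in> G)" for e G
    by (rule hc_ext) (auto simp: elts_name_val N_def)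
  ultimately show ?thesis unfolding rep_at_def by blast
qed

lemma rep_real_at: "rep (\<lambda>G e. e k \<in> real_at G (e i))"
proof -
  have t: "dterm (\<lambda>e. bit (e i) (e k) b)" for b
    unfolding bit_def by (intro dterm_upd_coord dfn_intros dterm_const[OF top_cond_M])
  have 1: "rep_at 0 (\<lambda>G e. bit (e i) (e k) b \<in> G)" if "b \<in> {0, 1}" for b
    using that by (intro rep_at_0_single[where t="\<lambda>e. bit (e i) (e k) b"] t bit_Qc omega_envD)
  show ?thesis
  proof (rule rep_from_0)
    show "rep_at 0 (\<lambda>G e. e k \<in> real_at G (e i))"
      by (rule rep_at_cong[OF 1[of 1]]) (auto simp: real_at_def omega_envD)
    show "rep_at 0 (\<lambda>G e. e k \<notin> real_at G (e i))"
      by (rule rep_at_cong[OF 1[of 0]]) (auto simp: bit0_G omega_envD)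
  qed
qed

text \<open>A fact about the indices that does not mention \<open>G\<close> is settled when the name
  is formed: separation keeps or removes its only element. This is how sets of \<open>M\<close>,
  such as the pairing \<open>c\<close>, enter names.\<close>

lemma rep_dfn:
  assumes "dfn P"
  shows "rep (\<lambda>G e. P e)"
proof -
  have *: "rep_at 0 (\<lambda>G e. P e)" if P: "dfn P" for P
  proof -
    define N where "N e = hcset {z \<in> elts (hcset {hpair hempty top_cond}). P e}" for e
    have "dterm N" unfolding N_def 
      by (intro dterm_sep dfn_intros dterm_const[OF top_cond_M]) (rule dfn_subst[OF P])
    moreover have N: "elts (N e) = (if P e then {hpair hempty top_cond} else {})" for e
      unfolding N_def by (subst elts_hcset[OF countable_sep]) auto
    moreover have "is_name Qc (N e)" for e
      by (rule is_name.intros) (use top_cond_Qc is_name_hempty in \<open>auto simp: N split: if_splits\<close>)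
    moreover have "name_val G (N e) = tv 0 (P e)" if "gen G" for e G
      using G_top_cond[OF that] by (intro hc_ext) (auto simp: elts_name_val N)
    ultimately show ?thesis unfolding rep_at_def by blast
  qed
  show ?thesis by (intro rep_from_0 * dfn_neg assms)
qed

lemmas rep_intros = rep_not rep_conj rep_imp rep_iff rep_all rep_ex

end

section \<open>Sets of \<open>M\<close> coded by reals\<close>

context zf_model
begin

lemma hsuc_inj_omega: "m \<in> elts homega \<Longrightarrow> n \<in> elts homega \<Longrightarrow> hsuc m = hsuc n \<Longrightarrow> m = n"
  by (auto simp: elts_homega hnat_Suc_hsuc[symmetric] inj_eq[OF inj_hnat])

lemma hsuc_neq_hempty: "hsuc m \<noteq> hempty"
  by (metis elts_hsuc hempty_elts insert_not_empty)

definition hprod :: "hc \<Rightarrow> hc \<Rightarrow> hc" where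
  "hprod x y = hUnion (hcset ((\<lambda>u. hcset ((\<lambda>v. hpair u v) ` elts y)) ` elts x))"

lemma elts_hprod [simp]: "elts (hprod x y) = (\<lambda>(u, v). hpair u v) ` (elts x \<times> elts y)"
  by (auto simp: hprod_def)

lemma hprod_M: "x \<in> M \<Longrightarrow> y \<in> M \<Longrightarrow> hprod x y \<in> M"
proof -
  assume "x \<in> M" "y \<in> M"
  then have "dterm (\<lambda>e. hcset ((\<lambda>u. hcset ((\<lambda>v. hpair u v) ` elts y)) ` elts x))"
    by (intro dterm_image dfn_intros dterm_const)
  from hUnion_M[OF dterm_M[OF this, of "\<lambda>_. x"]] \<open>x \<in> M\<close> show ?thesis by (simp add: hprod_def)
qed

definition htrans :: "hc \<Rightarrow> bool" where
  "htrans t \<longleftrightarrow> (\<forall>u\<in>elts t. \<forall>v\<in>elts u. v \<in> elts t)"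

lemma dfn_htrans: "dterm t \<Longrightarrow> dfn (\<lambda>e. htrans (t e))"
  by (rule dfn_comp1[where R=htrans]) (auto simp: htrans_def intro!: dfn_intros)

text \<open>Induction outside \<open>M\<close>, with one use of collection inside \<open>M\<close>
  at each step, takes the place of a recursion inside \<open>M\<close>.\<close>

lemma transitive_superset:
  "x \<in> M \<Longrightarrow> \<exists>t\<in>M. x \<in> elts t \<and> htrans t"
proof (induction x rule: hc_induct)
  case (step x)
  have "\<exists>t\<in>M. y \<in> elts t \<and> htrans t" if "y \<in> elts x" for y
    using step.IH[OF that] trans[OF step.prems that] .
  moreover have "dfn (\<lambda>e. e 0 \<in> elts (e (Suc 0)) \<and> htrans (e (Suc 0)))"
    by (intro dfn_intros dfn_htrans)
  ultimately obtain b where b: "b \<in> M" "\<And>y. y \<in> elts x \<Longrightarrow> \<exists>t\<in>elts b. y \<in> elts t \<and> htrans t"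
    using collection[where P="\<lambda>e y t. y \<in> elts t \<and> htrans t" and e="\<lambda>_. x" and a=x] step.prems
    by (metis (no_types, lifting) Menv_const)
  \<comment> \<open>The collecting set \<open>b\<close> may also contain sets that are not
    transitive; they are removed before the union is formed.\<close>
  define S where "S = hUnion (hcset {t \<in> elts b. htrans t})"
  have S: "S \<in> M" unfolding S_def by (intro hUnion_M hcset_sep_M dfn_htrans dterm_var b(1))
  have xS: "elts x \<subseteq> elts S" using b(2) by (force simp: S_def)
  have trS: "htrans S" unfolding htrans_def S_def by (auto simp: htrans_def)
  define T where "T = hcset (insert x (elts S))"
  have "T \<in> M" unfolding T_def hinsert_eq
    by (intro hUnion_M pair_M S) (use pair_M[OF step.prems step.prems] in simp)
  moreover have "elts T = insert x (elts S)" by (simp add: T_def)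
  then have "x \<in> elts T" "htrans T" using xS trS by (auto simp: htrans_def)
  ultimately show ?case by blast
qed

end

locale coded_model = zf_model +
  fixes c :: hc
  assumes all_countable: "every_set_countable_in M"
    and c_M: "c \<in> M"
    and c_dom: "\<And>m n. m \<in> elts homega \<Longrightarrow> n \<in> elts homega \<Longrightarrow> \<exists>k\<in>elts homega. hpair (hpair m n) k \<in> elts c"
    and c_inj: "\<And>z z' k. hpair z k \<in> elts c \<Longrightarrow> hpair z' k \<in> elts c \<Longrightarrow> z = z'"

text \<open>The pairing of natural numbers comes from the countability of \<omega> \<times> \<omega>
  in \<open>M\<close>, which avoids arithmetic.\<close>

lemma (in zf_model) coded_model_ex:
  assumes "every_set_countable_in M"
  shows "\<exists>c. coded_model M c"
proof -
  obtain f where f: "f \<in> M" "hfunction f" "hinjective f" "hdom f = elts (hprod homega homega)" "hran f \<subseteq> elts homega"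
    using assms hprod_M[OF homega_M homega_M] unfolding every_set_countable_in_def by blast
  have "coded_model M f"
  proof (unfold_locales)
    fix m n assume "m \<in> elts homega" "n \<in> elts homega"
    then have "hpair m n \<in> hdom f" using f(4) by force
    then show "\<exists>k\<in>elts homega. hpair (hpair m n) k \<in> elts f"
      using f(5) unfolding hdom_def hran_def by blast
  next
    show "z = z'" if "hpair z k \<in> elts f" "hpair z' k \<in> elts f" for z z' k
      using f(3) that unfolding hinjective_def by blast
  qed (use f(1) assms in blast)+
  then show ?thesis by blast
qed

context coded_model
begin

text \<open>
  \<open>c\<close> is an injection of \<open>\<omega> \<times> \<omega>\<close> into \<open>\<omega>\<close>, so a real \<open>y\<close> codes a relation on \<open>\<omega>\<close>, and, if this relation is
  well-founded, the set to which its Mostowski collapse maps \<open>0\<close>.  Extensionality is not required.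
\<close>

definition enc_rel :: "hc set \<Rightarrow> hc \<Rightarrow> hc \<Rightarrow> bool" where
  "enc_rel y m n \<longleftrightarrow> (\<exists>k\<in>elts homega. hpair (hpair m n) k \<in> elts c \<and> k \<in> y)"

lemma dfn_enc_rel: "dterm y \<Longrightarrow> dterm t \<Longrightarrow> dterm s \<Longrightarrow> dfn (\<lambda>e. enc_rel (elts (y e)) (t e) (s e))"
  by (rule dfn_comp3[where R="\<lambda>y. enc_rel (elts y)"]) (auto simp: enc_rel_def intro!: dfn_intros dterm_const[OF c_M])

text \<open>The source of all reals constructed below as codes, those of sets in
  \<open>code_ex\<close> and those of bisimulations in \<open>simulation_ex\<close>.\<close>

lemma enc_rel_ex:
  assumes "dfn (\<lambda>e. R (e 0) (e (Suc 0)))"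
  shows "\<exists>y\<in>M. elts y \<subseteq> elts homega \<and>
    (\<forall>m\<in>elts homega. \<forall>n\<in>elts homega. enc_rel (elts y) m n \<longleftrightarrow> R m n)"
proof (intro bexI conjI ballI)
  let ?y = "hcset {k \<in> elts homega. \<exists>m\<in>elts homega. \<exists>n\<in>elts homega. hpair (hpair m n) k \<in> elts c \<and> R m n}"
  have R: "dfn (\<lambda>e. R (e 1) (e 0))"
    by (rule dfn_comp2[where R=R, OF assms dterm_var dterm_var])
  show "?y \<in> M"
    by (intro hcset_sep_M dfn_intros dterm_const[OF c_M] homega_M) (use R in simp)
  show "elts ?y \<subseteq> elts homega" by auto
  show "enc_rel (elts ?y) m n \<longleftrightarrow> R m n" if mn: "m \<in> elts homega" "n \<in> elts homega" for m n
  proof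
    assume "enc_rel (elts ?y) m n"
    then obtain k m' n' where "hpair (hpair m n) k \<in> elts c" "hpair (hpair m' n') k \<in> elts c" "R m' n'"
      unfolding enc_rel_def by auto
    then show "R m n" using c_inj by fastforce
  next
    assume "R m n"
    then show "enc_rel (elts ?y) m n" using c_dom[OF mn] mn unfolding enc_rel_def by auto
  qed
qed

text \<open>
  Bisimulations between the coded relation and \<open>\<in>\<close> replace partial collapsing functions, since
  unions of bisimulations are bisimulations without any compatibility condition.
\<close>

definition collapsing :: "hc set \<Rightarrow> hc \<Rightarrow> bool" where
  "collapsing y r \<longleftrightarrow> (\<forall>n\<in>elts homega. \<forall>a\<in>M. hpair n a \<in> elts r \<longrightarrow>
     (\<forall>m\<in>elts homega. enc_rel y m n \<longrightarrow> (\<exists>b\<in>elts a. hpair m b \<in> elts r)) \<and>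
     (\<forall>b\<in>elts a. \<exists>m\<in>elts homega. enc_rel y m n \<and> hpair m b \<in> elts r))"

lemma dfn_collapsing: "dterm y \<Longrightarrow> dterm t \<Longrightarrow> dfn (\<lambda>e. collapsing (elts (y e)) (t e))"
  by (rule dfn_comp2[where R="\<lambda>y. collapsing (elts y)"]) (auto simp: collapsing_def intro!: dfn_intros dfn_enc_rel)

definition decodes :: "hc set \<Rightarrow> hc \<Rightarrow> hc \<Rightarrow> bool" where
  "decodes y n a \<longleftrightarrow> (\<exists>r\<in>M. collapsing y r \<and> hpair n a \<in> elts r)"

lemma dfn_decodes: "dterm y \<Longrightarrow> dterm t \<Longrightarrow> dterm s \<Longrightarrow> dfn (\<lambda>e. decodes (elts (y e)) (t e) (s e))"
  by (rule dfn_comp3[where R="\<lambda>y. decodes (elts y)"]) (auto simp: decodes_def intro!: dfn_intros dfn_collapsing)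

lemma decodes_M: "decodes y n a \<Longrightarrow> a \<in> M"
  unfolding decodes_def using hpair_elts_M by blast

lemma decodes_child: "decodes y n a \<Longrightarrow> n \<in> elts homega \<Longrightarrow> m \<in> elts homega \<Longrightarrow> enc_rel y m n \<Longrightarrow> \<exists>b\<in>elts a. decodes y m b"
proof -
  assume h: "decodes y n a" "n \<in> elts homega" "m \<in> elts homega" "enc_rel y m n"
  then obtain r where "r \<in> M" "collapsing y r" "hpair n a \<in> elts r" unfolding decodes_def by blast
  then show ?thesis using h decodes_M[OF h(1)] unfolding collapsing_def decodes_def by blast
qed

lemma decodes_elem: "decodes y n a \<Longrightarrow> n \<in> elts homega \<Longrightarrow> b \<in> elts a \<Longrightarrow> \<exists>m\<in>elts homega. enc_rel y m n \<and> decodes y m b"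
proof -
  assume h: "decodes y n a" "n \<in> elts homega" "b \<in> elts a"
  then obtain r where "r \<in> M" "collapsing y r" "hpair n a \<in> elts r" unfolding decodes_def by blast
  then show ?thesis using h decodes_M[OF h(1)] unfolding collapsing_def decodes_def by blast
qed

text \<open>A bisimulation between two coded relations, coded by a real itself. It speaks of reals
  and natural numbers only, so it can be expressed by names, whereas \<open>decodes\<close>
  quantifies over sets of \<open>M\<close>.\<close>

definition simulation :: "hc set \<Rightarrow> hc set \<Rightarrow> hc set \<Rightarrow> bool" where
  "simulation z x y \<longleftrightarrow> (\<forall>u\<in>elts homega. \<forall>v\<in>elts homega. enc_rel z u v \<longrightarrow>
     (\<forall>u'\<in>elts homega. enc_rel x u' u \<longrightarrow> (\<exists>v'\<in>elts homega. enc_rel y v' v \<and> enc_rel z u' v')) \<and>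
     (\<forall>v'\<in>elts homega. enc_rel y v' v \<longrightarrow> (\<exists>u'\<in>elts homega. enc_rel x u' u \<and> enc_rel z u' v')))"

lemma simulation_eq:
  assumes z: "simulation z x y"
  shows "decodes x m a \<Longrightarrow> decodes y n b \<Longrightarrow> m \<in> elts homega \<Longrightarrow> n \<in> elts homega \<Longrightarrow> enc_rel z m n \<Longrightarrow> a = b"
proof (induction a arbitrary: m n b rule: hc_induct)
  case (step a)
  have s1: "\<And>u'. u' \<in> elts homega \<Longrightarrow> enc_rel x u' m \<Longrightarrow> \<exists>v'\<in>elts homega. enc_rel y v' n \<and> enc_rel z u' v'"
    and s2: "\<And>v'. v' \<in> elts homega \<Longrightarrow> enc_rel y v' n \<Longrightarrow> \<exists>u'\<in>elts homega. enc_rel x u' m \<and> enc_rel z u' v'"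
    using z step.prems(3-5) unfolding simulation_def by blast+
  show ?case
  proof (intro hc_ext subset_antisym subsetI)
    fix a' assume a': "a' \<in> elts a"
    then obtain m' where m': "m' \<in> elts homega" "enc_rel x m' m" "decodes x m' a'"
      using decodes_elem step.prems by blast
    then obtain n' where n': "n' \<in> elts homega" "enc_rel y n' n" "enc_rel z m' n'" using s1 by blast
    then obtain b' where "b' \<in> elts b" "decodes y n' b'" using decodes_child step.prems by blast
    then show "a' \<in> elts b" using step.IH[OF a' m'(3) _ m'(1) n'(1,3)] by blast
  next
    fix b' assume b': "b' \<in> elts b"
    then obtain n' where n': "n' \<in> elts homega" "enc_rel y n' n" "decodes y n' b'"
      using decodes_elem step.prems by blast
    then obtain m' where m': "m' \<in> elts homega" "enc_rel x m' m" "enc_rel z m' n'" using s2 by blast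
    then obtain a' where "a' \<in> elts a" "decodes x m' a'" using decodes_child step.prems by blast
    then show "b' \<in> elts a" using step.IH[OF _ _ n'(3) m'(1) n'(1) m'(3)] by blast
  qed
qed

text \<open>Decoding to the same set is a bisimulation and is definable, so a real of
  \<open>M\<close> codes it. By \<open>real_at_surj\<close>, this real occurs in every generic
  sequence.\<close>

lemma simulation_ex:
  assumes x: "x \<in> M" and y: "y \<in> M"
  obtains z where "z \<in> M" "elts z \<subseteq> elts homega" "simulation (elts z) (elts x) (elts y)"
    "\<And>m n. m \<in> elts homega \<Longrightarrow> n \<in> elts homega \<Longrightarrow>
       enc_rel (elts z) m n \<longleftrightarrow> (\<exists>a\<in>M. decodes (elts x) m a \<and> decodes (elts y) n a)"
proof -
  have "dfn (\<lambda>e. \<exists>a\<in>M. decodes (elts x) (e 0) a \<and> decodes (elts y) (e (Suc 0)) a)"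
    by (intro dfn_intros dfn_decodes dterm_const[OF x] dterm_const[OF y])
  from enc_rel_ex[where R="\<lambda>m n. \<exists>a\<in>M. decodes (elts x) m a \<and> decodes (elts y) n a", OF this]
  obtain z where z: "z \<in> M" "elts z \<subseteq> elts homega" and
    Ez: "\<And>m n. m \<in> elts homega \<Longrightarrow> n \<in> elts homega \<Longrightarrow>
       enc_rel (elts z) m n \<longleftrightarrow> (\<exists>a\<in>M. decodes (elts x) m a \<and> decodes (elts y) n a)"
    by blast
  have "simulation (elts z) (elts x) (elts y)"
    unfolding simulation_def
  proof (intro ballI impI conjI)
    fix u v assume uv: "u \<in> elts homega" "v \<in> elts homega" "enc_rel (elts z) u v"
    then obtain a where a: "decodes (elts x) u a" "decodes (elts y) v a" using Ez by blast
    show "\<exists>v'\<in>elts homega. enc_rel (elts y) v' v \<and> enc_rel (elts z) u' v'" if u': "u' \<in> elts homega" "enc_rel (elts x) u' u" for u'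
    proof -
      obtain b where b: "b \<in> elts a" "decodes (elts x) u' b" using decodes_child[OF a(1) uv(1) u'] by blast
      then obtain v' where "v' \<in> elts homega" "enc_rel (elts y) v' v" "decodes (elts y) v' b"
        using decodes_elem[OF a(2) uv(2)] by blast
      then show ?thesis using Ez u' b decodes_M by blast
    qed
    show "\<exists>u'\<in>elts homega. enc_rel (elts x) u' u \<and> enc_rel (elts z) u' v'" if v': "v' \<in> elts homega" "enc_rel (elts y) v' v" for v'
    proof -
      obtain b where b: "b \<in> elts a" "decodes (elts y) v' b" using decodes_child[OF a(2) uv(2) v'] by blast
      then obtain u' where "u' \<in> elts homega" "enc_rel (elts x) u' u" "decodes (elts x) u' b"
        using decodes_elem[OF a(1) uv(1)] by blast
      then show ?thesis using Ez v' b decodes_M by blast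
    qed
  qed
  then show ?thesis using that z Ez by blast
qed

text \<open>The bisimulation of \<open>y\<close> with itself relates \<open>n\<close> to
  \<open>n\<close> as soon as \<open>n\<close> decodes to something; \<open>simulation_eq\<close>
  then identifies any two results.\<close>

lemma decodes_unique:
  assumes "y \<in> M" "decodes (elts y) n a" "decodes (elts y) n b" "n \<in> elts homega"
  shows "a = b"
proof -
  obtain z where z: "simulation (elts z) (elts y) (elts y)"
    and Ez: "\<And>m n. m \<in> elts homega \<Longrightarrow> n \<in> elts homega \<Longrightarrow>
       enc_rel (elts z) m n \<longleftrightarrow> (\<exists>a\<in>M. decodes (elts y) m a \<and> decodes (elts y) n a)"
    using simulation_ex[OF assms(1,1)] by metis
  then have "enc_rel (elts z) n n" using assms decodes_M by blast
  then show ?thesis using simulation_eq[OF z] assms by blast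
qed

text \<open>Minimal elements are required only for sets in \<open>M\<close>. This suffices for
  decoding, because the undecodable nodes form a set of \<open>M\<close>, and it becomes a
  quantifier over indices, because the subsets of \<omega> in \<open>M\<close> are exactly the reals
  of the generic sequence.\<close>

definition wf_in_M :: "hc set \<Rightarrow> bool" where
  "wf_in_M y \<longleftrightarrow> (\<forall>A\<in>M. (\<exists>n\<in>elts homega. n \<in> elts A) \<longrightarrow>
     (\<exists>n\<in>elts homega. n \<in> elts A \<and> (\<forall>m\<in>elts homega. m \<in> elts A \<longrightarrow> \<not> enc_rel y m n)))"

lemma dfn_wf_in_M: "dterm y \<Longrightarrow> dfn (\<lambda>e. wf_in_M (elts (y e)))"
  by (rule dfn_comp1[where R="\<lambda>y. wf_in_M (elts y)"]) (auto simp: wf_in_M_def intro!: dfn_intros dfn_enc_rel)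

text \<open>Mostowski collapse without recursion. At a minimal node \<open>k\<close> that decodes to
  nothing, the bisimulations for its predecessors are collected and united, and one more pair gives
  \<open>k\<close> a value.\<close>

lemma wf_in_M_decodes:
  assumes y: "y \<in> M" and wf: "wf_in_M (elts y)" and n: "n \<in> elts homega"
  shows "\<exists>a\<in>M. decodes (elts y) n a"
proof (rule ccontr)
  assume neg: "\<not> ?thesis"
  define A where "A = hcset {n \<in> elts homega. \<not> (\<exists>a\<in>M. decodes (elts y) n a)}"
  have A: "elts A = {n \<in> elts homega. \<not> (\<exists>a\<in>M. decodes (elts y) n a)}"
    by (simp add: A_def)
  have AM: "A \<in> M" unfolding A_def
    by (intro hcset_sep_M dfn_intros dfn_decodes dterm_const[OF y] homega_M)
  have ne: "\<exists>n\<in>elts homega. n \<in> elts A"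
    using n neg unfolding A by blast
  from wf[unfolded wf_in_M_def, THEN bspec, OF AM, THEN mp, OF ne]
  obtain k where k: "k \<in> elts homega" "k \<in> elts A" "\<And>m. m \<in> elts homega \<Longrightarrow> m \<in> elts A \<Longrightarrow> \<not> enc_rel (elts y) m k"
    by blast
  have ch: "\<exists>b\<in>M. decodes (elts y) m b" if "m \<in> elts homega" "enc_rel (elts y) m k" for m
    using k that unfolding A by blast
  define Pr where "Pr = hcset {m \<in> elts homega. enc_rel (elts y) m k}"
  have Pr: "elts Pr = {m \<in> elts homega. enc_rel (elts y) m k}" by (simp add: Pr_def)
  have PrM: "Pr \<in> M" unfolding Pr_def
    by (intro hcset_sep_M dfn_enc_rel dterm_const[OF y] dterm_const[OF omega_M[OF k(1)]] dterm_var homega_M)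
  let ?P = "\<lambda>m r. collapsing (elts y) r \<and> (\<exists>b\<in>M. hpair m b \<in> elts r)"
  have dP: "dfn (\<lambda>e. ?P (e 0) (e (Suc 0)))"
    by (intro dfn_intros dfn_collapsing dterm_const[OF y])
  have ex: "\<exists>r\<in>M. ?P m r" if "m \<in> elts Pr" for m
    using ch that unfolding Pr decodes_def by blast
  have Me: "Menv (\<lambda>_. y)" using y by simp
  have "\<exists>S\<in>M. \<forall>m\<in>elts Pr. \<exists>r\<in>elts S. ?P m r"
  proof (rule collection[where P="\<lambda>e. ?P" and e="\<lambda>_. y" and a=Pr, OF dP PrM Me ex])
    fix S assume "S \<in> M" and S: "\<And>m. m \<in> elts Pr \<Longrightarrow> \<exists>r\<in>elts S. ?P m r"
    show "\<exists>S\<in>M. \<forall>m\<in>elts Pr. \<exists>r\<in>elts S. ?P m r"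
      by (rule bexI[of _ S]) (use S \<open>S \<in> M\<close> in auto)
  qed
  then obtain S where S: "S \<in> M" "\<forall>m\<in>elts Pr. \<exists>r\<in>elts S. ?P m r"
    by (rule bexE)
  \<comment> \<open>Collection may add sets that are not bisimulations; only the bisimulations among
    them are united.\<close>
  define r where "r = hUnion (hcset {r \<in> elts S. collapsing (elts y) r})"
  have r: "elts r = (\<Union>x\<in>{r \<in> elts S. collapsing (elts y) r}. elts x)" by (simp add: r_def)
  have rM: "r \<in> M" unfolding r_def by (intro hUnion_M hcset_sep_M dfn_collapsing dterm_const[OF y] dterm_var S(1))
  \<comment> \<open>For a Kuratowski pair in \<open>r\<close>, the second component lies in the
    double union of \<open>r\<close>, which bounds the separation.\<close>
  define a where "a = hcset {b \<in> elts (hUnion (hUnion r)). \<exists>m\<in>elts homega. enc_rel (elts y) m k \<and> hpair m b \<in> elts r}"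
  have aM: "a \<in> M" unfolding a_def
    by (intro hcset_sep_M dfn_intros dfn_enc_rel dterm_const[OF y] dterm_const[OF rM] dterm_const[OF omega_M[OF k(1)]] hUnion_M rM)
  have a: "b \<in> elts a \<longleftrightarrow> (\<exists>m\<in>elts homega. enc_rel (elts y) m k \<and> hpair m b \<in> elts r)" for b
  proof -
    have "b \<in> elts (hUnion (hUnion r))" if "hpair m b \<in> elts r" for m
    proof -
      have "hcset {m, b} \<in> elts (hpair m b)" "b \<in> elts (hcset {m, b})" by (simp_all add: hpair_def)
      then show ?thesis unfolding elts_hUnion using that by blast
    qed
    then show ?thesis unfolding a_def elts_hcset[OF countable_sep] by blast
  qed
  define r' where "r' = hcset (insert (hpair k a) (elts r))"
  have r': "elts r' = insert (hpair k a) (elts r)" by (simp add: r'_def)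
  have kaM: "hpair k a \<in> M" using aM omega_M[OF k(1)] by (simp add: hpair_M_iff)
  have "r' \<in> M" unfolding r'_def hinsert_eq
    by (intro hUnion_M pair_M rM) (use pair_M[OF kaM kaM] in simp)
  moreover have "collapsing (elts y) r'"
    unfolding collapsing_def
  proof (intro ballI impI)
    fix n b assume n: "n \<in> elts homega" and b: "b \<in> M" and nb: "hpair n b \<in> elts r'"
    show "(\<forall>m\<in>elts homega. enc_rel (elts y) m n \<longrightarrow> (\<exists>b\<in>elts b. hpair m b \<in> elts r')) \<and>
       (\<forall>b\<in>elts b. \<exists>m\<in>elts homega. enc_rel (elts y) m n \<and> hpair m b \<in> elts r')"
    proof (cases "hpair n b \<in> elts r")
      case True
      then obtain x where x: "x \<in> elts S" "collapsing (elts y) x" "hpair n b \<in> elts x" unfolding r by blast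
      then have "elts x \<subseteq> elts r'" unfolding r' r by blast
      moreover have "(\<forall>m\<in>elts homega. enc_rel (elts y) m n \<longrightarrow> (\<exists>b\<in>elts b. hpair m b \<in> elts x)) \<and>
       (\<forall>b\<in>elts b. \<exists>m\<in>elts homega. enc_rel (elts y) m n \<and> hpair m b \<in> elts x)"
        using x n b unfolding collapsing_def by blast
      ultimately show ?thesis by blast
    next
      case False
      then have eq: "n = k" "b = a" using nb r' by auto
      have "\<exists>b\<in>elts a. hpair m b \<in> elts r'" if m: "m \<in> elts homega" "enc_rel (elts y) m k" for m
      proof -
        have "m \<in> elts Pr" using m by (simp add: Pr)
        then obtain x b where "x \<in> elts S" "collapsing (elts y) x" "hpair m b \<in> elts x" using bspec[OF S(2)] by blast
        then have "hpair m b \<in> elts r" unfolding r by blast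
        then show ?thesis using a m r' by blast
      qed
      moreover have "\<exists>m\<in>elts homega. enc_rel (elts y) m k \<and> hpair m b \<in> elts r'" if "b \<in> elts a" for b
        using that a r' by blast
      ultimately show ?thesis using eq by blast
    qed
  qed
  ultimately have "decodes (elts y) k a" unfolding decodes_def r'_def by auto
  then show False using k(2) aM unfolding A by blast
qed

lemma code_ex:
  assumes a: "a \<in> M"
  shows "\<exists>y\<in>M. elts y \<subseteq> elts homega \<and> wf_in_M (elts y) \<and> decodes (elts y) (hnat 0) a"
proof -
  obtain t where t: "t \<in> M" "a \<in> elts t" "htrans t" using transitive_superset[OF a] by blast
  obtain f where f: "f \<in> M" "hfunction f" "hinjective f" "hdom f = elts t" "hran f \<subseteq> elts homega"
    using all_countable t(1) unfolding every_set_countable_in_def by blast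
  have fdom: "\<exists>k\<in>elts homega. hpair v k \<in> elts f" if "v \<in> elts t" for v
    using f(4,5) that unfolding hdom_def hran_def by blast
  have fran: "k \<in> elts homega" if "hpair v k \<in> elts f" for v k
    using f(5) that unfolding hran_def by blast
  have finj: "v = v'" if "hpair v k \<in> elts f" "hpair v' k \<in> elts f" for v v' k
    using f(3) that unfolding hinjective_def by blast
  \<comment> \<open>Number 0 is reserved for \<open>a\<close>, so the values of \<open>f\<close> are
    shifted by one. The set \<open>a\<close> keeps its shifted number as well; a set may have
    several numbers, as the coded relation need not be extensional.\<close>
  define N where "N n v \<longleftrightarrow> (n = hempty \<and> v = a) \<or> (\<exists>k\<in>elts homega. hpair v k \<in> elts f \<and> n = hsuc k)" for n v
  have dN: "dterm s \<Longrightarrow> dterm u \<Longrightarrow> dfn (\<lambda>e. N (s e) (u e))" for s u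
    by (rule dfn_comp2[where R=N]) (auto simp: N_def intro!: dfn_intros dterm_const[OF a] dterm_const[OF f(1)])
  have Nfun: "v = v'" if "N n v" "N n v'" for n v v'
    using that hsuc_inj_omega hsuc_neq_hempty finj unfolding N_def by metis
  have Nex: "\<exists>n\<in>elts homega. N n v" if v: "v \<in> elts t" for v
  proof -
    obtain k where k: "k \<in> elts homega" "hpair v k \<in> elts f" using fdom[OF v] by blast
    then have "hsuc k \<in> elts homega" by (auto simp: elts_homega hnat_Suc_hsuc[symmetric])
    then show ?thesis using k unfolding N_def by blast
  qed
  have "dfn (\<lambda>e. \<exists>u\<in>elts t. \<exists>v\<in>elts t. N (e 0) u \<and> N (e (Suc 0)) v \<and> u \<in> elts v)"
    by (intro dfn_intros dN dterm_const[OF t(1)])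
  from enc_rel_ex[where R="\<lambda>m n. \<exists>u\<in>elts t. \<exists>v\<in>elts t. N m u \<and> N n v \<and> u \<in> elts v", OF this]
  obtain y where y: "y \<in> M" "elts y \<subseteq> elts homega" and
    Ey: "\<And>m n. m \<in> elts homega \<Longrightarrow> n \<in> elts homega \<Longrightarrow>
      enc_rel (elts y) m n \<longleftrightarrow> (\<exists>u\<in>elts t. \<exists>v\<in>elts t. N m u \<and> N n v \<and> u \<in> elts v)"
    by blast
  have "wf_in_M (elts y)" unfolding wf_in_M_def
  proof (intro ballI impI)
    fix A assume "\<exists>n\<in>elts homega. n \<in> elts A"
    then obtain n where n: "n \<in> elts homega" "n \<in> elts A" by blast
    let ?G = "\<exists>n\<in>elts homega. n \<in> elts A \<and> (\<forall>m\<in>elts homega. m \<in> elts A \<longrightarrow> \<not> enc_rel (elts y) m n)"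
    \<comment> \<open>Membership induction on the set \<open>v\<close> denoted by \<open>n\<close>:
      a predecessor of \<open>n\<close> in \<open>A\<close> denotes an element of
      \<open>v\<close>.\<close>
    have "N n v \<longrightarrow> n \<in> elts homega \<longrightarrow> n \<in> elts A \<longrightarrow> ?G" for n v
    proof (induction v arbitrary: n rule: hc_induct)
      case (step v)
      show ?case
      proof (intro impI)
        assume n: "N n v" "n \<in> elts homega" "n \<in> elts A"
        show ?G
        proof (cases "\<forall>m\<in>elts homega. m \<in> elts A \<longrightarrow> \<not> enc_rel (elts y) m n")
          case True
          then show ?thesis using n by blast
        next
          case False
          then obtain m where m: "m \<in> elts homega" "m \<in> elts A" "enc_rel (elts y) m n" by blast
          then obtain u v' where "N m u" "N n v'" "u \<in> elts v'" using Ey n by blast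
          then show ?thesis using step m Nfun[OF n(1)] by blast
        qed
      qed
    qed
    \<comment> \<open>A number that denotes no set has no predecessors, hence is minimal in every
      set that contains it.\<close>
    moreover have ?G if "\<not> (\<exists>v. N n v)" using that n Ey by blast
    ultimately show ?G using n by blast
  qed
  moreover have "decodes (elts y) (hnat 0) a"
  proof -
    define r where "r = hcset {z \<in> elts (hprod homega t). \<exists>n\<in>elts homega. \<exists>v\<in>elts t. z = hpair n v \<and> N n v}"
    have rM: "r \<in> M" unfolding r_def
      by (intro hcset_sep_M dfn_intros dN dterm_const[OF t(1)] hprod_M homega_M t(1))
    have r: "hpair n v \<in> elts r \<longleftrightarrow> n \<in> elts homega \<and> v \<in> elts t \<and> N n v" for n v
      unfolding r_def elts_hcset[OF countable_sep] by auto
    have "collapsing (elts y) r" unfolding collapsing_def r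
    proof (intro ballI impI conjI)
      fix n v assume n: "n \<in> elts homega" and h: "n \<in> elts homega \<and> v \<in> elts t \<and> N n v"
      show "\<exists>b\<in>elts v. m \<in> elts homega \<and> b \<in> elts t \<and> N m b" if m: "m \<in> elts homega" "enc_rel (elts y) m n" for m
      proof -
        obtain u v' where u: "u \<in> elts t" "N m u" "N n v'" "u \<in> elts v'" using Ey[OF m(1) n] m(2) by blast
        then have "v' = v" using Nfun h by blast
        then show ?thesis using u m by blast
      qed
      show "\<exists>m\<in>elts homega. enc_rel (elts y) m n \<and> m \<in> elts homega \<and> b \<in> elts t \<and> N m b" if b: "b \<in> elts v" for b
      proof -
        have bt: "b \<in> elts t" using t(3) h b unfolding htrans_def by blast
        then obtain m where m: "m \<in> elts homega" "N m b" using Nex by blast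
        then have "enc_rel (elts y) m n" using Ey[OF m(1) n] bt h b by blast
        then show ?thesis using m bt by blast
      qed
    qed
    moreover have "hpair (hnat 0) a \<in> elts r"
      unfolding r using t(2) by (simp add: N_def hempty_hnat)
    ultimately show ?thesis using rM unfolding decodes_def by blast
  qed
  ultimately show ?thesis using y by blast
qed

section \<open>Truth in the ground model\<close>

definition good :: "hc set \<Rightarrow> hc \<Rightarrow> bool" where
  "good G i \<longleftrightarrow> wf_in_M (real_at G i)"

definition val :: "hc set \<Rightarrow> hc \<Rightarrow> hc" where
  "val G i = (THE a. decodes (real_at G i) (hnat 0) a)"

lemma val_eq:
  assumes "gen G" "i \<in> elts homega" "decodes (real_at G i) (hnat 0) a"
  shows "val G i = a"
proof -
  obtain y where y: "y \<in> M" "elts y = real_at G i" using real_at_M[OF assms(1,2)] by blast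
  have "b = a" if "decodes (real_at G i) (hnat 0) b" for b
    using decodes_unique[OF y(1), of "hnat 0" b a] that assms(3) y(2) by simp
  then show ?thesis unfolding val_def using assms(3) by (rule the_equality[rotated])
qed

lemma val_decodes:
  assumes "gen G" "i \<in> elts homega" "good G i"
  shows "decodes (real_at G i) (hnat 0) (val G i)" "val G i \<in> M"
proof -
  obtain y where y: "y \<in> M" "elts y = real_at G i" using real_at_M[OF assms(1,2)] by blast
  obtain a where a: "decodes (real_at G i) (hnat 0) a"
    using wf_in_M_decodes[OF y(1), of "hnat 0"] assms(3) unfolding good_def y(2) by auto
  then show "decodes (real_at G i) (hnat 0) (val G i)" using val_eq[OF assms(1,2) a] by simp
  then show "val G i \<in> M" by (rule decodes_M)
qed

lemma val_surj:
  assumes "gen G" "a \<in> M"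
  shows "\<exists>i\<in>elts homega. good G i \<and> val G i = a"
proof -
  obtain y where y: "y \<in> M" "elts y \<subseteq> elts homega" "wf_in_M (elts y)" "decodes (elts y) (hnat 0) a"
    using code_ex[OF assms(2)] by blast
  obtain i where i: "i \<in> elts homega" "real_at G i = elts y" using real_at_surj[OF assms(1) y(1,2)] by blast
  have "good G i" "val G i = a" using y val_eq[OF assms(1) i(1), of a] i(2) unfolding good_def by auto
  then show ?thesis using i(1) by blast
qed

text \<open>Equality of two decoded nodes in terms of indices: a bisimulation witnessing it is a
  real of \<open>M\<close>, so it can be sought among the reals of the sequence.\<close>

definition same :: "hc set \<Rightarrow> hc \<Rightarrow> hc \<Rightarrow> hc \<Rightarrow> hc \<Rightarrow> bool" where
  "same G i m j n \<longleftrightarrow> (\<exists>l\<in>elts homega. enc_rel (real_at G l) m n \<and> simulation (real_at G l) (real_at G i) (real_at G j))"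

lemma same_iff:
  assumes G: "gen G" and i: "i \<in> elts homega" and j: "j \<in> elts homega"
    and m: "m \<in> elts homega" and n: "n \<in> elts homega"
    and a: "decodes (real_at G i) m a" and b: "decodes (real_at G j) n b"
  shows "same G i m j n \<longleftrightarrow> a = b"
proof
  assume "same G i m j n"
  then show "a = b" unfolding same_def using simulation_eq[OF _ a b m n] by blast
next
  assume ab: "a = b"
  obtain x where x: "x \<in> M" "elts x = real_at G i" using real_at_M[OF G i] by blast
  obtain y where y: "y \<in> M" "elts y = real_at G j" using real_at_M[OF G j] by blast
  obtain z where z: "z \<in> M" "elts z \<subseteq> elts homega" "simulation (elts z) (elts x) (elts y)"
    and Ez: "enc_rel (elts z) m n \<longleftrightarrow> (\<exists>a\<in>M. decodes (elts x) m a \<and> decodes (elts y) n a)"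
    by (rule simulation_ex[OF x(1) y(1)]) (use m n in blast)
  obtain l where "l \<in> elts homega" "real_at G l = elts z" using real_at_surj[OF G z(1,2)] by blast
  moreover have "enc_rel (elts z) m n" using Ez a b ab decodes_M[OF a] x(2) y(2) by auto
  ultimately show "same G i m j n" unfolding same_def using z(3) x(2) y(2) by (intro bexI[of _ l]) auto
qed

lemma val_eq_iff:
  assumes "gen G" "i \<in> elts homega" "j \<in> elts homega" "good G i" "good G j"
  shows "same G i (hnat 0) j (hnat 0) \<longleftrightarrow> val G i = val G j"
  using assms by (intro same_iff val_decodes hnat_omega)

lemma val_mem_iff:
  assumes G: "gen G" and i: "i \<in> elts homega" and j: "j \<in> elts homega" and "good G i" "good G j"
  shows "(\<exists>n\<in>elts homega. enc_rel (real_at G j) n (hnat 0) \<and> same G i (hnat 0) j n) \<longleftrightarrow> val G i \<in> elts (val G j)"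
proof
  note vi = val_decodes(1)[OF G i assms(4)] and vj = val_decodes(1)[OF G j assms(5)]
  show "val G i \<in> elts (val G j)" if h: "\<exists>n\<in>elts homega. enc_rel (real_at G j) n (hnat 0) \<and> same G i (hnat 0) j n"
  proof -
    obtain n where n: "n \<in> elts homega" "enc_rel (real_at G j) n (hnat 0)" "same G i (hnat 0) j n" using h by blast
    obtain b where b: "b \<in> elts (val G j)" "decodes (real_at G j) n b"
      using decodes_child[OF vj hnat_omega n(1,2)] by blast
    then show ?thesis using same_iff[OF G i j hnat_omega n(1) vi b(2)] n(3) by simp
  qed
  assume "val G i \<in> elts (val G j)"
  then obtain n where n: "n \<in> elts homega" "enc_rel (real_at G j) n (hnat 0)" "decodes (real_at G j) n (val G i)"
    using decodes_elem[OF vj hnat_omega] by blast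
  then show "\<exists>n\<in>elts homega. enc_rel (real_at G j) n (hnat 0) \<and> same G i (hnat 0) j n"
    using same_iff[OF G i j hnat_omega n(1) vi n(3)] by blast
qed

lemma rep_enc_rel: "rep (\<lambda>G e. enc_rel (real_at G (e i)) (e m) (e n))"
  unfolding enc_rel_def by (intro rep_intros rep_real_at rep_dfn dfn_intros dterm_const[OF c_M])

lemma rep_same: "rep (\<lambda>G e. same G (e i) (e m) (e j) (e n))"
  unfolding same_def simulation_def by (intro rep_intros rep_enc_rel)

lemma rep_good: "rep (\<lambda>G e. good G (e i))"
proof (rule rep_cong)
  show "rep (\<lambda>G e. \<forall>j\<in>elts homega. (\<exists>n\<in>elts homega. n \<in> real_at G j) \<longrightarrow>
     (\<exists>n\<in>elts homega. n \<in> real_at G j \<and> (\<forall>m\<in>elts homega. m \<in> real_at G j \<longrightarrow> \<not> enc_rel (real_at G (e i)) m n)))"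
    by (intro rep_intros rep_real_at rep_enc_rel)
  fix G e assume G: "gen G" and e: "omega_env e"
  let ?R = "\<lambda>A. (\<exists>n\<in>elts homega. n \<in> A) \<longrightarrow>
     (\<exists>n\<in>elts homega. n \<in> A \<and> (\<forall>m\<in>elts homega. m \<in> A \<longrightarrow> \<not> enc_rel (real_at G (e i)) m n))"
  show "(\<forall>j\<in>elts homega. ?R (real_at G j)) = good G (e i)"
  proof
    assume h: "\<forall>j\<in>elts homega. ?R (real_at G j)"
    show "good G (e i)" unfolding good_def wf_in_M_def
    proof
      fix A assume A: "A \<in> M"
      \<comment> \<open>Well-foundedness tests only the part of \<open>A\<close> inside \<omega>,
        and this part is a real of \<open>M\<close>, hence some \<open>real_at G j\<close>.\<close>
      define A' where "A' = hcset {n \<in> elts homega. n \<in> elts A}"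
      have A': "elts A' = {n \<in> elts homega. n \<in> elts A}" by (simp add: A'_def)
      have A'M: "A' \<in> M" unfolding A'_def by (intro hcset_sep_M dfn_intros dterm_const[OF A] homega_M)
      have "elts A' \<subseteq> elts homega" unfolding A' by blast
      from real_at_surj[OF G A'M this] obtain j where j: "j \<in> elts homega" "real_at G j = elts A'" by blast
      have "?R (elts A')" using bspec[OF h j(1)] j(2) by simp
      then show "?R (elts A)" unfolding A' by blast
    qed
  next
    assume h: "good G (e i)"
    show "\<forall>j\<in>elts homega. ?R (real_at G j)"
    proof
      fix j assume "j \<in> elts homega"
      then obtain y where "y \<in> M" "elts y = real_at G j" using real_at_M[OF G] by blast
      then show "?R (real_at G j)" using h unfolding good_def wf_in_M_def by metis
    qed
  qed
qed

lemma rep_val_eq: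
  "\<exists>B. rep B \<and> (\<forall>G e. gen G \<longrightarrow> omega_env e \<longrightarrow> good G (e i) \<longrightarrow> good G (e j) \<longrightarrow>
    B G e = (val G (e i) = val G (e j)))"
proof (intro exI conjI allI impI)
  \<comment> \<open>\<open>rep_same\<close> takes its arguments from the environment, so the
    constant 0 is introduced as a quantified variable \<open>z\<close>.\<close>
  show "rep (\<lambda>G e. \<exists>z\<in>elts homega. z = hnat 0 \<and> same G (e i) z (e j) z)"
    by (intro rep_intros rep_same rep_dfn dfn_intros)
  show "(\<exists>z\<in>elts homega. z = hnat 0 \<and> same G (e i) z (e j) z) = (val G (e i) = val G (e j))"
    if "gen G" "omega_env e" "good G (e i)" "good G (e j)" for G e
    using val_eq_iff[OF that(1) omega_envD[OF that(2)] omega_envD[OF that(2)] that(3,4)] hnat_omega[of 0] by blast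
qed

lemma rep_val_mem:
  "\<exists>B. rep B \<and> (\<forall>G e. gen G \<longrightarrow> omega_env e \<longrightarrow> good G (e i) \<longrightarrow> good G (e j) \<longrightarrow>
    B G e = (val G (e i) \<in> elts (val G (e j))))"
proof (intro exI conjI allI impI)
  show "rep (\<lambda>G e. \<exists>z\<in>elts homega. z = hnat 0 \<and>
      (\<exists>n\<in>elts homega. enc_rel (real_at G (e j)) n z \<and> same G (e i) z (e j) n))"
    by (intro rep_intros rep_same rep_enc_rel rep_dfn dfn_intros)
  show "(\<exists>z\<in>elts homega. z = hnat 0 \<and>
      (\<exists>n\<in>elts homega. enc_rel (real_at G (e j)) n z \<and> same G (e i) z (e j) n)) = (val G (e i) \<in> elts (val G (e j)))"
    if "gen G" "omega_env e" "good G (e i)" "good G (e j)" for G e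
    using val_mem_iff[OF that(1) omega_envD[OF that(2)] omega_envD[OF that(2)] that(3,4)] hnat_omega[of 0] by blast
qed

text \<open>The induction runs outside \<open>M\<close>, with a separate \<open>B\<close> for each
  formula, and the available levels may rise with it. Goodness of the indices ensures that
  \<open>val\<close> is the decoded set and not an arbitrary choice.\<close>

lemma rep_sat:
  "fm_over m 0 \<phi> \<Longrightarrow> \<exists>B. rep B \<and> (\<forall>G e. gen G \<longrightarrow> omega_env e \<longrightarrow> (\<forall>k<m. good G (e k)) \<longrightarrow>
     B G e = sat M [] \<phi> (map (\<lambda>k. val G (e k)) [0..<m]))"
proof (induction \<phi> arbitrary: m)
  case (Mem i j)
  obtain B where "rep B" "\<forall>G e. gen G \<longrightarrow> omega_env e \<longrightarrow> good G (e i) \<longrightarrow> good G (e j) \<longrightarrow>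
    B G e = (val G (e i) \<in> elts (val G (e j)))"
    using rep_val_mem[of i j] by blast
  then show ?case using Mem by (intro exI[of _ B]) auto
next
  case (Eq i j)
  obtain B where "rep B" "\<forall>G e. gen G \<longrightarrow> omega_env e \<longrightarrow> good G (e i) \<longrightarrow> good G (e j) \<longrightarrow>
    B G e = (val G (e i) = val G (e j))"
    using rep_val_eq[of i j] by blast
  then show ?case using Eq by (intro exI[of _ B]) auto
next
  case (Cls i k)
  then show ?case by simp
next
  case (Neg \<phi>)
  from Neg.IH[of m] Neg.prems obtain B where "rep B" "\<forall>G e. gen G \<longrightarrow> omega_env e \<longrightarrow> (\<forall>k<m. good G (e k)) \<longrightarrow>
     B G e = sat M [] \<phi> (map (\<lambda>k. val G (e k)) [0..<m])" by auto
  then show ?case by (intro exI[of _ "\<lambda>G e. \<not> B G e"]) (auto intro: rep_not)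
next
  case (Conj \<phi> \<psi>)
  from Conj.IH(1)[of m] Conj.prems obtain B1 where "rep B1" "\<forall>G e. gen G \<longrightarrow> omega_env e \<longrightarrow> (\<forall>k<m. good G (e k)) \<longrightarrow>
     B1 G e = sat M [] \<phi> (map (\<lambda>k. val G (e k)) [0..<m])" by auto
  moreover from Conj.IH(2)[of m] Conj.prems obtain B2 where "rep B2" "\<forall>G e. gen G \<longrightarrow> omega_env e \<longrightarrow> (\<forall>k<m. good G (e k)) \<longrightarrow>
     B2 G e = sat M [] \<psi> (map (\<lambda>k. val G (e k)) [0..<m])" by auto
  ultimately show ?case by (intro exI[of _ "\<lambda>G e. B1 G e \<and> B2 G e"]) (auto intro: rep_conj)
next
  case (Ex \<phi>)
  from Ex.IH[of "Suc m"] Ex.prems obtain B where B: "rep B" "\<And>G e. gen G \<Longrightarrow> omega_env e \<Longrightarrow> (\<forall>k<Suc m. good G (e k)) \<Longrightarrow>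
     B G e = sat M [] \<phi> (map (\<lambda>k. val G (e k)) [0..<Suc m])" by auto
  let ?B = "\<lambda>G e. \<exists>i\<in>elts homega. good G i \<and> B G (case_nat i e)"
  have "rep ?B"
    by (intro rep_intros rep_good) (simp add: B(1))
  moreover have "?B G e = sat M [] (Ex \<phi>) (map (\<lambda>k. val G (e k)) [0..<m])"
    if h: "gen G" "omega_env e" "\<forall>k<m. good G (e k)" for G e
  proof -
    have *: "B G (case_nat i e) = sat M [] \<phi> (val G i # map (\<lambda>k. val G (e k)) [0..<m])"
      if "i \<in> elts homega" "good G i" for i
    proof -
      have "\<forall>k<Suc m. good G (case_nat i e k)" using that h by (auto split: nat.split)
      from B(2)[OF h(1) _ this] that h(2)
      have "B G (case_nat i e) = sat M [] \<phi> (map (\<lambda>k. val G (case_nat i e k)) [0..<Suc m])" by simp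
      also have "map (\<lambda>k. val G (case_nat i e k)) [0..<Suc m] = val G i # map (\<lambda>k. val G (e k)) [0..<m]"
        by (simp add: map_upt_Suc del: upt_Suc)
      finally show ?thesis .
    qed
    have "?B G e \<longleftrightarrow> (\<exists>i\<in>elts homega. good G i \<and> sat M [] \<phi> (val G i # map (\<lambda>k. val G (e k)) [0..<m]))"
      using * by blast
    \<comment> \<open>\<open>val G\<close> maps the good indices onto \<open>M\<close>, so a
      quantifier over \<open>M\<close> is one over good indices.\<close>
    also have "\<dots> \<longleftrightarrow> (\<exists>x\<in>M. sat M [] \<phi> (x # map (\<lambda>k. val G (e k)) [0..<m]))"
      using val_surj[OF h(1)] val_decodes(2)[OF h(1)] by metis
    finally show ?thesis by simp
  qed
  ultimately show ?case by blast
qed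

text \<open>The index at which a parameter \<open>a\<close> appears varies with \<open>G\<close>, so
  it cannot be built into a name. A fixed code \<open>y\<close> of \<open>a\<close> can: the name
  searches for an index whose real is \<open>y\<close>.\<close>

lemma rep_sat_params:
  "fm_over (m + length ps) 0 \<phi> \<Longrightarrow> set ps \<subseteq> M \<Longrightarrow>
   \<exists>B. rep B \<and> (\<forall>G e. gen G \<longrightarrow> omega_env e \<longrightarrow> (\<forall>k<m. good G (e k)) \<longrightarrow>
     B G e = sat M [] \<phi> (map (\<lambda>k. val G (e k)) [0..<m] @ ps))"
proof (induction ps arbitrary: m)
  case Nil
  then show ?case using rep_sat[of m \<phi>] by simp
next
  case (Cons a ps)
  then have a: "a \<in> M" by simp
  obtain B where B: "rep B" "\<And>G e. gen G \<Longrightarrow> omega_env e \<Longrightarrow> (\<forall>k<Suc m. good G (e k)) \<Longrightarrow>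
     B G e = sat M [] \<phi> (map (\<lambda>k. val G (e k)) [0..<Suc m] @ ps)"
    using Cons.IH[of "Suc m"] Cons.prems by auto
  obtain y where y: "y \<in> M" "elts y \<subseteq> elts homega" "wf_in_M (elts y)" "decodes (elts y) (hnat 0) a"
    using code_ex[OF a] by blast
  let ?B = "\<lambda>G e. \<exists>i\<in>elts homega. (\<forall>k\<in>elts homega. k \<in> real_at G i \<longleftrightarrow> k \<in> elts y) \<and> B G (\<lambda>k. if k = m then i else e k)"
  \<comment> \<open>The bound index, variable 0, goes to slot \<open>m\<close>, which the induction
    hypothesis for \<open>Suc m\<close> provides for the head of the parameter list.\<close>
  have "rep (\<lambda>G e. B G (\<lambda>k. e (if k = m then 0 else Suc k)))"
    by (rule rep_subst[OF B(1)])
  moreover have "(\<lambda>k. e (if k = m then 0 else Suc k)) = (\<lambda>k. if k = m then e 0 else e (Suc k))" for e :: "nat \<Rightarrow> hc"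
    by auto
  ultimately have "rep (\<lambda>G e. B G (\<lambda>k. if k = m then e 0 else e (Suc k)))" by simp
  then have "rep ?B"
    by (intro rep_intros rep_real_at rep_dfn dfn_mem dterm_var dterm_const[OF y(1)])
  moreover have "?B G e = sat M [] \<phi> (map (\<lambda>k. val G (e k)) [0..<m] @ a # ps)"
    if h: "gen G" "omega_env e" "\<forall>k<m. good G (e k)" for G e
  proof -
    have eq: "(\<forall>k\<in>elts homega. k \<in> real_at G i \<longleftrightarrow> k \<in> elts y) \<longleftrightarrow> real_at G i = elts y" for i
      using y(2) unfolding real_at_def by blast
    have *: "B G (\<lambda>k. if k = m then i else e k) = sat M [] \<phi> (map (\<lambda>k. val G (e k)) [0..<m] @ a # ps)"
      if i: "i \<in> elts homega" "real_at G i = elts y" for i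
    proof -
      have "good G i" "val G i = a" using val_eq[OF h(1) i(1)] i(2) y unfolding good_def by auto
      moreover have "omega_env (\<lambda>k. if k = m then i else e k)" using h(2) i(1) by (simp add: omega_env_def)
      moreover have "\<forall>k<Suc m. good G (if k = m then i else e k)" using h(3) \<open>good G i\<close> by (simp add: less_Suc_eq)
      moreover have "map (\<lambda>k. val G (if k = m then i else e k)) [0..<Suc m] @ ps = map (\<lambda>k. val G (e k)) [0..<m] @ a # ps"
        using \<open>val G i = a\<close> by auto
      ultimately show ?thesis using B(2)[OF h(1), of "\<lambda>k. if k = m then i else e k"] by (simp only:)
    qed
    show ?thesis unfolding eq using * real_at_surj[OF h(1) y(1,2)] by blast
  qed
  ultimately show ?case by blast
qed

section \<open>Diagonalization\<close>

text \<open>This is a relation over \<open>M\<close> that mentions no generic filter, because it has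
  to occur in the definition of the diagonal class.\<close>

definition codes :: "hc \<Rightarrow> hc \<Rightarrow> bool" where
  "codes p a \<longleftrightarrow> (\<exists>y\<in>M. (\<forall>k\<in>elts y. k \<in> elts homega) \<and> wf_in_M (elts y) \<and> decodes (elts y) (hnat 0) a \<and>
     (\<exists>q\<in>M. hpair (hnat 0) q \<in> elts p \<and> char_cond (elts y) q))"

lemma dfn_codes: "dterm t \<Longrightarrow> dterm s \<Longrightarrow> dfn (\<lambda>e. codes (t e) (s e))"
  by (rule dfn_comp2[where R=codes])
    (auto simp: codes_def intro!: dfn_intros dfn_wf_in_M dfn_decodes dfn_char_cond)

lemma codes_ex: "a \<in> M \<Longrightarrow> \<exists>p\<in>Qc. codes p a"
proof -
  assume "a \<in> M"
  then obtain y where y: "y \<in> M" "elts y \<subseteq> elts homega" "wf_in_M (elts y)" "decodes (elts y) (hnat 0) a"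
    using code_ex by blast
  obtain q where q: "q \<in> Pc" "char_cond (elts y) q" using char_cond_ex[OF y(1)] by blast
  have "upd_coord top_cond (hnat 0) q \<in> Qc" by (intro upd_coord_Qc top_cond_Qc hnat_omega q(1))
  moreover have "codes (upd_coord top_cond (hnat 0) q) a"
    unfolding codes_def using y q Pc_M[OF q(1)] by (intro bexI[of _ y] conjI bexI[of _ q]) auto
  ultimately show ?thesis by blast
qed

lemma codes_val:
  assumes G: "gen G" and p: "p \<in> G" "codes p a"
  shows "good G (hnat 0)" "val G (hnat 0) = a"
proof -
  obtain y q where y: "y \<in> M" "elts y \<subseteq> elts homega" "wf_in_M (elts y)" "decodes (elts y) (hnat 0) a"
    and q: "hpair (hnat 0) q \<in> elts p" "char_cond (elts y) q"
    using p(2) unfolding codes_def by blast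
  have "q = coord p (hnat 0)" using coord_iff[OF G_Qc[OF G p(1)]] q(1) by simp
  then have "real_at G (hnat 0) = elts y" using real_at_char_cond[OF G hnat_omega p(1) _ y(2)] q(2) by simp
  then show "good G (hnat 0)" "val G (hnat 0) = a"
    using y val_eq[OF G hnat_omega] unfolding good_def by auto
qed

text \<open>The set \<open>a\<close> enters through \<open>p\<close>, and \<sigma> is chosen before
  \<open>a\<close>. One name thus serves all \<open>a\<close>, including those built from \<sigma>
  itself.\<close>

lemma class_name_ex:
  assumes "dfn (\<lambda>e. e 0 \<in> X)"
  shows "\<exists>n. \<exists>\<sigma>\<in>set_names M Qc. \<forall>G p a. gen G \<longrightarrow> p \<in> G \<longrightarrow> a \<in> M \<longrightarrow> codes p a \<longrightarrow>
    name_val G \<sigma> = tv n (a \<in> X)"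
proof -
  obtain \<phi> m ps where 1: "set ps \<subseteq> M" "fm_over (m + length ps) 0 \<phi>"
    and 2: "\<And>e. Menv e \<Longrightarrow> sat M [] \<phi> (map e [0..<m] @ ps) = (e 0 \<in> X)"
    using assms unfolding dfn_def by blast
  obtain B where B: "rep B" "\<And>G e. gen G \<Longrightarrow> omega_env e \<Longrightarrow> (\<forall>k<m. good G (e k)) \<Longrightarrow>
     B G e = sat M [] \<phi> (map (\<lambda>k. val G (e k)) [0..<m] @ ps)"
    using rep_sat_params[OF 1(2,1)] by blast
  obtain n where "rep_at n B" using B(1) unfolding rep_def by blast
  then obtain N where N: "dterm N" "\<And>e. omega_env e \<Longrightarrow> is_name Qc (N e)"
    "\<And>e G. omega_env e \<Longrightarrow> gen G \<Longrightarrow> name_val G (N e) = tv n (B G e)"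
    unfolding rep_at_def by blast
  \<comment> \<open>All variables point to index 0, which \<open>codes_val\<close> shows to be good;
    this secures goodness for all \<open>m\<close> variables of the formula at once.\<close>
  define e0 where "e0 = (\<lambda>k :: nat. hnat 0)"
  have e0: "omega_env e0" by (simp add: omega_env_def e0_def)
  show ?thesis
  proof (intro exI bexI allI impI)
    show "N e0 \<in> set_names M Qc"
      using dterm_M[OF N(1) omega_env_Menv[OF e0]] N(2)[OF e0] by (simp add: set_names_def)
    fix G p a assume h: "gen G" "p \<in> G" "a \<in> M" "codes p a"
    have "B G e0 = sat M [] \<phi> (map (\<lambda>k. a) [0..<m] @ ps)"
      using B(2)[OF h(1) e0] codes_val[OF h(1,2,4)] by (simp add: e0_def)
    also have "\<dots> = (a \<in> X)" using 2[of "\<lambda>k. a"] h(3) by simp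
    finally show "name_val G (N e0) = tv n (a \<in> X)" using N(3)[OF e0 h(1)] by simp
  qed
qed

lemma no_forcing_theorem:
  assumes cM: "countable M"
  shows "\<not> forcing_theorem M (definable_classes M) Qc (Q_le M)"
proof
  let ?C = "definable_classes M"
  let ?F = "\<lambda>p \<sigma>s. forces M ?C Qc (Q_le M) p [] (Eq 0 1) \<sigma>s"
  define U where "U = {htuple p \<sigma>s | p \<sigma>s. p \<in> Qc \<and> length \<sigma>s = 2 \<and> set \<sigma>s \<subseteq> set_names M Qc \<and> ?F p \<sigma>s}"
  assume "forcing_theorem M ?C Qc (Q_le M)"
  then have "\<forall>m \<phi> \<Gamma>s. fm_over m (length \<Gamma>s) \<phi> \<longrightarrow> set \<Gamma>s \<subseteq> class_names ?C Qc \<longrightarrow>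
      {htuple p \<sigma>s | p \<sigma>s. p \<in> Qc \<and> length \<sigma>s = m \<and> set \<sigma>s \<subseteq> set_names M Qc \<and>
        forces M ?C Qc (Q_le M) p \<Gamma>s \<phi> \<sigma>s} \<in> ?C"
    unfolding forcing_theorem_def by blast
  from this[rule_format, of 2 "[]" "Eq 0 1"] have "U \<in> ?C" unfolding U_def by simp
  then have U: "dfn (\<lambda>e. e 0 \<in> U)" using dfn_class by blast
  have U_iff: "hpair p (hpair \<sigma> \<tau>) \<in> U \<longleftrightarrow> ?F p [\<sigma>, \<tau>]"
    if "p \<in> Qc" "\<sigma> \<in> set_names M Qc" "\<tau> \<in> set_names M Qc" for p \<sigma> \<tau>
  proof
    assume "hpair p (hpair \<sigma> \<tau>) \<in> U"
    then obtain p' \<sigma>s where *: "hpair p (hpair \<sigma> \<tau>) = htuple p' \<sigma>s" "length \<sigma>s = 2" "?F p' \<sigma>s"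
      unfolding U_def by blast
    then obtain s t where "\<sigma>s = [s, t]" by (auto simp: length_Suc_conv numeral_2_eq_2)
    then show "?F p [\<sigma>, \<tau>]" using * by simp
  next
    assume "?F p [\<sigma>, \<tau>]"
    then show "hpair p (hpair \<sigma> \<tau>) \<in> U"
      unfolding U_def using that by (intro CollectI exI[of _ p] exI[of _ "[\<sigma>, \<tau>]"]) simp
  qed
  \<comment> \<open>The condition that codes \<open>a\<close> has to be quantified here; for the
    pair chosen below, \<open>key\<close> shows that all such conditions give the same
    answer.\<close>
  define D where "D = {a \<in> M. \<exists>p\<in>M. p \<in> Qc \<and> codes p a \<and> hpair p a \<notin> U}"
  have "dfn (\<lambda>e. hpair (e 0) (e (Suc 0)) \<in> U)"
    by (rule dfn_comp1[OF U]) (intro dfn_intros)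
  then have "dfn (\<lambda>e. e 0 \<in> D)" unfolding D_def mem_Collect_eq
    by (intro dfn_intros dfn_Qc dfn_codes)
  from class_name_ex[OF this] obtain n \<sigma> where \<sigma>: "\<sigma> \<in> set_names M Qc"
    "\<And>G p a. gen G \<Longrightarrow> p \<in> G \<Longrightarrow> a \<in> M \<Longrightarrow> codes p a \<Longrightarrow> name_val G \<sigma> = tv n (a \<in> D)"
    by blast
  define \<tau> where "\<tau> = tv_name n True"
  have \<tau>: "\<tau> \<in> set_names M Qc" by (simp add: \<tau>_def set_names_def tv_name_M is_name_tv_name)
  \<comment> \<open>The diagonal point: the two names that represent membership in \<open>D\<close>
    form the set whose membership is tested.\<close>
  define a where "a = hpair \<sigma> \<tau>"
  have aM: "a \<in> M" using \<sigma>(1) \<tau> by (simp add: a_def hpair_M_iff set_names_def)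
  have key: "hpair p a \<in> U \<longleftrightarrow> a \<in> D" if p: "p \<in> Qc" "codes p a" for p
  proof -
    have "hpair p a \<in> U \<longleftrightarrow> (\<forall>G. gen G \<longrightarrow> p \<in> G \<longrightarrow> name_val G \<sigma> = name_val G \<tau>)"
      unfolding a_def U_iff[OF p(1) \<sigma>(1) \<tau>] forces_def sat_extension_def by simp
    also have "\<dots> \<longleftrightarrow> (\<forall>G. gen G \<longrightarrow> p \<in> G \<longrightarrow> tv n (a \<in> D) = tv n True)"
      using \<sigma>(2)[OF _ _ aM p(2)] name_val_tv_name[OF G_top_cond] unfolding \<tau>_def by metis
    \<comment> \<open>If \<open>a \<notin> D\<close>, a generic filter through \<open>p\<close>
      refutes the equation; its existence rules out that \<open>p\<close> forces it
      vacuously.\<close>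
    also have "\<dots> \<longleftrightarrow> a \<in> D"
      using generic_ex[OF cM p(1)] tv_inj[of n] by (cases "a \<in> D") auto
    finally show ?thesis .
  qed
  show False
    \<comment> \<open>Some condition codes \<open>a\<close>, and by \<open>key\<close> every such
      condition puts its pair into \<open>U\<close> iff \<open>a \<in> D\<close>; so
      \<open>a \<in> D\<close> iff \<open>a \<notin> D\<close>.\<close>
    using key codes_ex[OF aM] aM Qc_M unfolding D_def by blast
qed

end

theorem theorem7p2:
  fixes M :: "hc set"
  assumes "countable M"
    and "transitive_set M"
    and "ZF_minus M"
    and "every_set_countable_in M"
  shows "\<not> forcing_theorem M (definable_classes M) (Q_conds M) (Q_le M)"
proof -
  interpret zf_model M using assms by unfold_locales
  obtain c where "coded_model M c" using coded_model_ex[OF assms(4)] by blast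
  then show ?thesis using coded_model.no_forcing_theorem assms(1) by blast
qed

end
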